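(* Let $r,s>1$ be integers, let $R$ and $S$ be transitive permutation groups of degree $r$ and $s$ respectively, and let $m\ge 3$ be an odd integer. Then there exist a finite connected graph $\Delta$ of valency $rs$ and an almost simple group $G\le\operatorname{Aut}(\Delta)$ such that $\Delta$ is $G$-arc-transitive and, for an arc $(x,y)$ of $\Delta$, the group $G_x^{\Delta(x)}$ is permutation isomorphic to $R\operatorname{wr}S$ (in its imprimitive action of degree $rs$) and $G_{x,y}^{[1]}\cong R^{s(m-2)+1}$.
   Context: Graphs are undirected, and an arc is an ordered pair of adjacent vertices. $\Delta$ is $G$-arc-transitive if $G$ acts transitively on the arcs of $\Delta$. For a vertex $z$, $\Delta(z)$ is the set of vertices adjacent to $z$, $G_z$ is the stabiliser of $z$ in $G$, $G_z^{\Delta(z)}$ is the permutation group induced by $G_z$ on $\Delta(z)$, and $G_z^{[1]}$ is the subgroup of $G_z$ fixing $\Delta(z)$ pointwise. For an arc $(x,y)$, $G_{x,y}^{[1]}=G_x^{[1]}\cap G_y^{[1]}$. $R\operatorname{wr}S=R^s\rtimes S$; if $R$ acts on $\{0,\ldots,r-1\}$ and $S$ on $\{0,\ldots,s-1\}$, its imprimitive action of degree $rs$ is the action on $\{0,\ldots,r-1\}\times\{0,\ldots,s-1\}$ given by $(z,i)^{(f_0,\ldots,f_{s-1})\tau}=(z^{f_i},i^\tau)$. $R^k$ is the direct product of $k$ copies of $R$. A finite group $G$ is almost simple if $T\le G\le \operatorname{Aut}(T)$, up to isomorphism, for some non-abelian finite simple group $T$. *)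

theory Defs
  imports
    "HOL-Algebra.Group_Action"
    "HOL-Algebra.SimpleGroups"
    "HOL-Algebra.Product_Groups"
    "Graph_Theory.Digraph_Component"
begin

section \<open>Permutation groups\<close>

text \<open>
  A permutation group on \<open>\<Omega>\<close> is a subgroup \<open>H\<close> of \<^const>\<open>BijGroup\<close> \<open>\<Omega>\<close>, given by its carrier set.
  Permutations act from the left; replacing each permutation by its inverse translates this into
  the convention of right actions, and changes neither \<open>H\<close> as a set of maps nor its isomorphism
  type.
\<close>

abbreviation perm_group :: "'a set \<Rightarrow> ('a \<Rightarrow> 'a) set \<Rightarrow> ('a \<Rightarrow> 'a) monoid" where
  "perm_group \<Omega> H \<equiv> BijGroup \<Omega>\<lparr>carrier := H\<rparr>"

definition transitive_perm_group :: "'a set \<Rightarrow> ('a \<Rightarrow> 'a) set \<Rightarrow> bool" where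
  "transitive_perm_group \<Omega> H \<longleftrightarrow>
     subgroup H (BijGroup \<Omega>) \<and> transitive_action (perm_group \<Omega> H) \<Omega> (\<lambda>h. h)"

definition perm_isomorphic ::
    "'a set \<Rightarrow> ('a \<Rightarrow> 'a) set \<Rightarrow> 'b set \<Rightarrow> ('b \<Rightarrow> 'b) set \<Rightarrow> bool" where
  "perm_isomorphic \<Omega> H \<Lambda> K \<longleftrightarrow>
     (\<exists>\<beta> \<psi>. bij_betw \<beta> \<Omega> \<Lambda> \<and> \<psi> \<in> iso (perm_group \<Omega> H) (perm_group \<Lambda> K) \<and>
            (\<forall>h\<in>H. \<forall>z\<in>\<Omega>. \<beta> (h z) = \<psi> h (\<beta> z)))"

text \<open>
  The imprimitive action of \<open>R wr S\<close> is faithful when \<open>\<Omega>\<close> is nonempty, so the wreath product in this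
  action is the set of permutations that its elements \<open>(f, \<tau>)\<close> induce on \<open>\<Omega> \<times> \<Sigma>\<close>.
\<close>

definition wreath_imprimitive ::
    "'a set \<Rightarrow> ('a \<Rightarrow> 'a) set \<Rightarrow> 'b set \<Rightarrow> ('b \<Rightarrow> 'b) set \<Rightarrow> ('a \<times> 'b \<Rightarrow> 'a \<times> 'b) set" where
  "wreath_imprimitive \<Omega> R \<Sigma> S =
     {\<lambda>(z, i)\<in>\<Omega> \<times> \<Sigma>. (f i z, \<tau> i) | f \<tau>. f \<in> \<Sigma> \<rightarrow> R \<and> \<tau> \<in> S}"

section \<open>Almost simple groups\<close>

definition inner_autos :: "('a, 'b) monoid_scheme \<Rightarrow> ('a \<Rightarrow> 'a) set" where
  "inner_autos T =
     (\<lambda>t. \<lambda>x\<in>carrier T. t \<otimes>\<^bsub>T\<^esub> x \<otimes>\<^bsub>T\<^esub> inv\<^bsub>T\<^esub> t) ` carrier T"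

text \<open>
  In \<open>T \<le> G \<le> Aut(T)\<close> the group \<open>T\<close> is identified with its inner automorphisms. Every finite group has
  an isomorphic copy whose elements are natural numbers, so it is enough to let \<open>T\<close> range over
  groups on that type.
\<close>

definition almost_simple :: "('a, 'b) monoid_scheme \<Rightarrow> bool" where
  "almost_simple G \<longleftrightarrow> group G \<and> finite (carrier G) \<and>
     (\<exists>(T :: nat monoid) H.
        simple_group T \<and> finite (carrier T) \<and> \<not> comm_group T \<and>
        subgroup H (AutoGroup T) \<and> inner_autos T \<subseteq> H \<and>
        G \<cong> AutoGroup T\<lparr>carrier := H\<rparr>)"

section \<open>Groups of automorphisms of graphs\<close>

definition graph_AutGroup :: "'a pair_pre_digraph \<Rightarrow> ('a \<Rightarrow> 'a) monoid" where
  "graph_AutGroup \<Delta> = perm_group (pverts \<Delta>)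
     {g \<in> Bij (pverts \<Delta>). \<forall>u\<in>pverts \<Delta>. \<forall>v\<in>pverts \<Delta>.
        (u, v) \<in> parcs \<Delta> \<longleftrightarrow> (g u, g v) \<in> parcs \<Delta>}"

definition arc_transitive :: "'a pair_pre_digraph \<Rightarrow> ('a \<Rightarrow> 'a) set \<Rightarrow> bool" where
  "arc_transitive \<Delta> G \<longleftrightarrow>
     transitive_action (perm_group (pverts \<Delta>) G) (parcs \<Delta>) (\<lambda>g. \<lambda>(u, v)\<in>parcs \<Delta>. (g u, g v))"

definition neighbours :: "'a pair_pre_digraph \<Rightarrow> 'a \<Rightarrow> 'a set" where
  "neighbours \<Delta> x = {y. (x, y) \<in> parcs \<Delta>}"

abbreviation vertex_stabiliser :: "'a pair_pre_digraph \<Rightarrow> ('a \<Rightarrow> 'a) set \<Rightarrow> 'a \<Rightarrow> ('a \<Rightarrow> 'a) set" where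
  "vertex_stabiliser \<Delta> G x \<equiv> stabilizer (perm_group (pverts \<Delta>) G) (\<lambda>g. g) x"

definition local_group :: "'a pair_pre_digraph \<Rightarrow> ('a \<Rightarrow> 'a) set \<Rightarrow> 'a \<Rightarrow> ('a \<Rightarrow> 'a) set" where
  "local_group \<Delta> G x = (\<lambda>g. restrict g (neighbours \<Delta> x)) ` vertex_stabiliser \<Delta> G x"

definition local_kernel :: "'a pair_pre_digraph \<Rightarrow> ('a \<Rightarrow> 'a) set \<Rightarrow> 'a \<Rightarrow> ('a \<Rightarrow> 'a) set" where
  "local_kernel \<Delta> G x = {g \<in> vertex_stabiliser \<Delta> G x. \<forall>y\<in>neighbours \<Delta> x. g y = y}"

definition arc_kernel :: "'a pair_pre_digraph \<Rightarrow> ('a \<Rightarrow> 'a) set \<Rightarrow> 'a \<Rightarrow> 'a \<Rightarrow> ('a \<Rightarrow> 'a) set" where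
  "arc_kernel \<Delta> G x y = local_kernel \<Delta> G x \<inter> local_kernel \<Delta> G y"

end

theory Submission
  imports Defs "HOL-Combinatorics.Perm"
begin

text \<open>
  Let \<open>S\<close> act on \<open>s m + 1\<close> coordinates with one fixed point and \<open>m\<close> copies of its natural action, and
  let \<open>A\<close> be the subgroup of \<open>R wr S\<close>, in its action on these coordinates, whose component at the
  fixed coordinate lies in a point stabiliser \<open>R\<^sub>0\<close>. Since \<open>m\<close> is odd, there is an involution \<open>t\<close> of the
  coordinates, commuting with the point stabiliser of \<open>S\<close>, that swaps the fixed coordinate with the
  base point of the first copy and pairs up the base points of the other copies. It normalises the stabiliser \<open>B\<close> in \<open>A\<close>
  of a point in the block of this base point, the action of \<open>A\<close> on \<open>A/B\<close> is the imprimitive action of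
  \<open>R wr S\<close>, and the \<open>c \<in> A\<close> such that both \<open>c\<close> and \<open>t c t\<close> lie in the kernel of this action form
  \<open>R\<^bsup>s(m-2)+1\<^esup>\<close>.

  It remains to realise \<open>A\<close> and \<open>t\<close> inside an almost simple group \<open>G = \<langle>A, t\<rangle>\<close> with \<open>A \<inter> A\<^sup>t = B\<close>; the
  graph is then the coset graph of \<open>(G, A, t)\<close>. Let \<open>A\<close> act on two copies of the imprimitive set
  (coordinates times \<open>{0, \<dots>, r - 1}\<close>), where the point fixed by \<open>A\<close> is deleted from the second copy.
  As \<open>t\<close> maps the fixed point of \<open>A\<close> in the first copy to a point with stabiliser \<open>B\<close>, we get
  \<open>A \<inter> A\<^sup>t = B\<close>. In the second copy, \<open>t\<close> has to fix the partner \<open>q\<close> of the deleted point, and this makes the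
  supports of some \<open>f \<in> A\<close> and of \<open>t f t\<close> meet only in \<open>q\<close>, so that \<open>[f, t f t]\<close> is a three-cycle. The points
  joined to \<open>q\<close> by three-cycles of \<open>G\<close> form a block which \<open>t\<close> and \<open>A\<close> preserve, hence everything, and \<open>G\<close>
  contains the alternating group.
\<close>

notation "apply" (infixl \<open>\<langle>$\<rangle>\<close> 999)

section \<open>Groups of finitely supported permutations\<close>

text \<open>Composition and inversion are total on finitely supported permutations, so subgroups can
  be kept as plain sets; algebraic structures are reached through
  \<open>perm_monoid\<close>.\<close>

definition perm_closed :: "'a perm set \<Rightarrow> bool" where
  "perm_closed G \<longleftrightarrow> 1 \<in> G \<and> (\<forall>g\<in>G. \<forall>h\<in>G. g * h \<in> G) \<and> (\<forall>g\<in>G. inverse g \<in> G)"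

abbreviation perm_monoid :: "'a perm set \<Rightarrow> 'a perm monoid" where
  "perm_monoid G \<equiv> \<lparr>carrier = G, monoid.mult = (*), one = 1\<rparr>"

definition perms_on :: "'a set \<Rightarrow> 'a perm set" where
  "perms_on \<Omega> = {g. affected g \<subseteq> \<Omega>}"

lemma perm_closedD:
  assumes "perm_closed G"
  shows "1 \<in> G" "g \<in> G \<Longrightarrow> h \<in> G \<Longrightarrow> g * h \<in> G" "g \<in> G \<Longrightarrow> inverse g \<in> G"
  using assms by (auto simp: perm_closed_def)

lemma group_perm_monoid: "perm_closed G \<Longrightarrow> group (perm_monoid G)"
  by (rule groupI) (auto simp: perm_closed_def mult.assoc intro: perm.left_inverse)

lemma inv_perm_monoid:
  assumes "perm_closed G" "g \<in> G"
  shows "inv\<^bsub>perm_monoid G\<^esub> g = inverse g"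
  using assms by (intro group.inv_equality[OF group_perm_monoid]) (auto simp: perm_closed_def)

lemma apply_inverse_apply [simp]:
  "inverse g \<langle>$\<rangle> (g \<langle>$\<rangle> x) = x" "g \<langle>$\<rangle> (inverse g \<langle>$\<rangle> x) = x"
  by (simp_all add: apply_sequence)

lemma inverse_mult_cancel [simp]:
  fixes g h :: "'a perm"
  shows "inverse g * (g * h) = h" "g * (inverse g * h) = h"
  by (simp_all flip: mult.assoc)

lemma perms_onD: "g \<in> perms_on \<Omega> \<Longrightarrow> x \<notin> \<Omega> \<Longrightarrow> g \<langle>$\<rangle> x = x"
  by (auto simp: perms_on_def in_affected)

lemma perms_on_apply_iff: "g \<in> perms_on \<Omega> \<Longrightarrow> g \<langle>$\<rangle> x \<in> \<Omega> \<longleftrightarrow> x \<in> \<Omega>"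
  by (metis apply_inj perms_onD)

lemma perm_closed_perms_on: "perm_closed (perms_on \<Omega>)"
  by (auto simp: perm_closed_def perms_on_def dest!: subsetD[OF affected_times])

lemma finite_perms_on:
  assumes "finite \<Omega>"
  shows "finite (perms_on \<Omega>)"
proof (rule finite_imageD)
  have "apply ` perms_on \<Omega> \<subseteq> {p. p permutes \<Omega>}"
    by (auto simp: permutes_def perms_onD apply_inj) (metis apply_inverse_apply(2))
  then show "finite (apply ` perms_on \<Omega>)"
    using finite_permutations[OF assms] finite_subset by blast
  show "inj_on apply (perms_on \<Omega>)"
    by (auto simp: inj_on_def intro: perm_eqI)
qed

text \<open>\<open>Perm\<close> is meaningful for bijections of the whole type with finite support.
  An injective self-map of a finite set is onto, and extending it by the identity gives such a
  bijection.\<close>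

lemma apply_Perm_of_inj_on:
  assumes "finite X" "f ` X \<subseteq> X" "inj_on f X" "\<And>x. x \<notin> X \<Longrightarrow> f x = x"
  shows "apply (Perm f) = f" "Perm f \<in> perms_on X"
proof -
  have "bij_betw f X X"
    using assms endo_inj_surj[of X f] by (simp add: bij_betw_def)
  then have "f permutes X"
    using assms(4) by (intro bij_imp_permutes) auto
  then have "bij f"
    by (rule permutes_bij)
  moreover have sub: "{x. f x \<noteq> x} \<subseteq> X"
    using assms(4) by blast
  ultimately show *: "apply (Perm f) = f"
    using assms(1) by (intro Perm_inverse) (auto intro: finite_subset)
  then show "Perm f \<in> perms_on X"
    using sub by (simp add: perms_on_def subset_iff in_affected)
qed

text \<open>Left multiplication by an element of \<open>A\<close> is an injective self-map of a
  finite set, hence onto. Solving \<open>a * b = a\<close> produces the unit, and then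
  \<open>a * b = 1\<close> the inverse.\<close>

lemma perm_closed_of_finite:
  assumes fin: "finite A" and ne: "A \<noteq> {}"
    and mult: "\<And>a b. a \<in> A \<Longrightarrow> b \<in> A \<Longrightarrow> a * b \<in> A"
  shows "perm_closed (A :: 'a perm set)"
proof -
  have surj: "\<exists>b\<in>A. a * b = c" if "a \<in> A" "c \<in> A" for a c
  proof -
    have "inj_on ((*) a) A"
      by (rule inj_onI) (metis inverse_mult_cancel(1))
    then have "(*) a ` A = A"
      using fin that mult by (intro endo_inj_surj) auto
    then show ?thesis
      using that by (metis imageE)
  qed
  have one: "1 \<in> A"
    using ne surj by (metis all_not_in_conv perm.left_inverse inverse_mult_cancel(1))
  have "inverse a \<in> A" if "a \<in> A" for a
    using surj[OF that one] by (metis inverse_mult_cancel(1) mult.right_neutral)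
  with one mult show ?thesis
    by (simp add: perm_closed_def)
qed

section \<open>Generated subgroups\<close>

definition perm_span :: "'a perm set \<Rightarrow> 'a perm set" where
  "perm_span X = \<Inter>{G. perm_closed G \<and> X \<subseteq> G}"

lemma perm_closed_perm_span: "perm_closed (perm_span X)"
  by (auto simp: perm_span_def perm_closed_def)

lemma perm_span_superset: "X \<subseteq> perm_span X"
  by (auto simp: perm_span_def)

lemma perm_span_least: "perm_closed G \<Longrightarrow> X \<subseteq> G \<Longrightarrow> perm_span X \<subseteq> G"
  by (auto simp: perm_span_def)

text \<open>Conjugation is a homomorphism. Taking this preimage as an upper bound reduces the
  invariance of a generated subgroup to its generators.\<close>

lemma perm_closed_conj_vimage:
  assumes "perm_closed G"
  shows "perm_closed {x. g * x * inverse g \<in> G}"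
proof -
  have mult: "g * (x * y) * inverse g = (g * x * inverse g) * (g * y * inverse g)" for x y
    by (simp add: mult.assoc)
  have inv: "g * inverse x * inverse g = inverse (g * x * inverse g)" for x
    by (simp add: mult.assoc)
  show ?thesis
    using assms unfolding perm_closed_def mem_Collect_eq mult inv by (simp del: perm.inverse_distrib_swap)
qed

section \<open>Three-cycles\<close>

definition cyc3 :: "'a \<Rightarrow> 'a \<Rightarrow> 'a \<Rightarrow> 'a perm" where
  "cyc3 a b c = swap a b * swap b c"

lemma apply_cyc3:
  assumes "distinct [a, b, c]"
  shows "cyc3 a b c \<langle>$\<rangle> x = (if x = a then b else if x = b then c else if x = c then a else x)"
  using assms by (auto simp: cyc3_def apply_times)

lemma cyc3_rotate: "distinct [a, b, c] \<Longrightarrow> cyc3 b c a = cyc3 a b c"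
  by (rule perm_eqI) (auto simp: apply_cyc3)

lemma inverse_cyc3: "distinct [a, b, c] \<Longrightarrow> inverse (cyc3 a b c) = cyc3 b a c"
  by (rule perm.inverse_unique, rule perm_eqI)
    (auto simp: apply_times apply_cyc3 split: if_splits)

lemma conj_cyc3:
  assumes "distinct [a, b, c]"
  shows "g * cyc3 a b c * inverse g = cyc3 (g \<langle>$\<rangle> a) (g \<langle>$\<rangle> b) (g \<langle>$\<rangle> c)"
proof (rule perm_eqI)
  fix x
  have d: "distinct [g \<langle>$\<rangle> a, g \<langle>$\<rangle> b, g \<langle>$\<rangle> c]"
    using assms by (simp add: apply_inj)
  obtain y where x: "x = g \<langle>$\<rangle> y"
    by (metis apply_inverse_apply(2))
  show "(g * cyc3 a b c * inverse g) \<langle>$\<rangle> x = cyc3 (g \<langle>$\<rangle> a) (g \<langle>$\<rangle> b) (g \<langle>$\<rangle> c) \<langle>$\<rangle> x"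
    unfolding x apply_cyc3[OF d] by (simp add: apply_times apply_cyc3[OF assms] apply_inj)
qed

lemma affected_cyc3: "distinct [a, b, c] \<Longrightarrow> affected (cyc3 a b c) = {a, b, c}"
  by (auto simp: in_affected apply_cyc3 split: if_splits)

lemma cyc3_closed:
  assumes "perm_closed G" "distinct [a, b, c]" "cyc3 a b c \<in> G"
  shows "cyc3 b c a \<in> G" "cyc3 c a b \<in> G" "cyc3 b a c \<in> G" "cyc3 a c b \<in> G" "cyc3 c b a \<in> G"
proof -
  show *: "cyc3 b c a \<in> G" "cyc3 c a b \<in> G" 
    using assms cyc3_rotate[of a b c] cyc3_rotate[of c a b] by auto
  show "cyc3 b a c \<in> G"
    using assms inverse_cyc3[of a b c] by (metis perm_closedD(3))
  show "cyc3 a c b \<in> G"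
    using assms * inverse_cyc3[of c a b] by (metis perm_closedD(3) distinct_length_2_or_more)
  show "cyc3 c b a \<in> G"
    using assms * inverse_cyc3[of b c a] by (metis perm_closedD(3) distinct_length_2_or_more)
qed

section \<open>Points joined by three-cycles\<close>

lemma cyc3_conj_mem:
  assumes "perm_closed G" "distinct [a, b, c]" "cyc3 a b c \<in> G" "g \<in> G"
  shows "cyc3 (g \<langle>$\<rangle> a) (g \<langle>$\<rangle> b) (g \<langle>$\<rangle> c) \<in> G"
  using assms by (metis conj_cyc3 perm_closedD(2,3))

text \<open>Up to rotation and inversion, some three-cycle of \<open>G\<close> moves both points;
  the equality makes the relation reflexive. For a subgroup it is an equivalence relation, and its
  classes are blocks for every permutation that normalises the subgroup.\<close>

definition cyc3_linked :: "'a perm set \<Rightarrow> 'a \<Rightarrow> 'a \<Rightarrow> bool" where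
  "cyc3_linked G a b \<longleftrightarrow> a = b \<or> (\<exists>c. distinct [a, b, c] \<and> cyc3 a b c \<in> G)"

lemma cyc3_linkedI: 
  "perm_closed G \<Longrightarrow> distinct [a, b, c] \<Longrightarrow> cyc3 a b c \<in> G \<Longrightarrow> cyc3_linked G a b \<and> cyc3_linked G a c"
  using cyc3_closed unfolding cyc3_linked_def by (metis distinct_length_2_or_more distinct_singleton)

lemma cyc3_linked_sym: "perm_closed G \<Longrightarrow> cyc3_linked G a b \<Longrightarrow> cyc3_linked G b a"
  unfolding cyc3_linked_def
  by (metis cyc3_closed(3) distinct_length_2_or_more)

text \<open>Conjugating \<open>cyc3 a b c\<close> by \<open>cyc3 b d e\<close> keeps
  \<open>a\<close> and replaces \<open>b\<close> by \<open>d\<close>, provided that \<open>e\<close>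
  is not \<open>a\<close>. The degenerate cases contain a three-cycle through \<open>a\<close> and
  \<open>d\<close> already.\<close>

lemma cyc3_linked_trans:
  assumes G: "perm_closed G" and ab: "cyc3_linked G a b" and bd: "cyc3_linked G b d"
  shows "cyc3_linked G a d"
proof (cases "a = b \<or> b = d \<or> a = d")
  case True
  then show ?thesis
    using ab bd by (auto simp: cyc3_linked_def)
next
  case False
  obtain c where c: "distinct [a, b, c]" "cyc3 a b c \<in> G"
    using ab False by (auto simp: cyc3_linked_def)
  obtain e where e: "distinct [b, d, e]" "cyc3 b d e \<in> G"
    using bd False by (auto simp: cyc3_linked_def)
  consider "e = a" | "c = d" | "e \<noteq> a" "c \<noteq> d"
    by blast
  then show ?thesis
  proof cases
    case 1
    then show ?thesis
      using cyc3_linkedI[OF G, of a b d] cyc3_closed(2)[OF G e] e by auto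
  next
    case 2
    then show ?thesis
      using cyc3_linkedI[OF G c] by simp
  next
    case 3
    define c' where "c' = cyc3 b d e \<langle>$\<rangle> c"
    have "cyc3 b d e \<langle>$\<rangle> a = a" "cyc3 b d e \<langle>$\<rangle> b = d"
      using 3 False by (auto simp: apply_cyc3[OF e(1)])
    then have "cyc3 a d c' \<in> G"
      using cyc3_conj_mem[OF G c e(2)] by (simp add: c'_def)
    moreover have "distinct [a, d, c']"
      using 3 False c(1) by (auto simp: c'_def apply_cyc3[OF e(1)])
    ultimately show ?thesis
      using cyc3_linkedI[OF G] by blast
  qed
qed

lemma cyc3_linked_image:
  assumes "perm_closed N" "cyc3_linked N a b" "\<And>n. n \<in> N \<Longrightarrow> g * n * inverse g \<in> N"
  shows "cyc3_linked N (g \<langle>$\<rangle> a) (g \<langle>$\<rangle> b)"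
  using assms unfolding cyc3_linked_def by (metis apply_inj conj_cyc3 distinct_length_2_or_more distinct_singleton)

text \<open>The link between \<open>a\<close> and \<open>b\<close> gives a three-cycle with some
  third point \<open>c\<close>, and a link between \<open>c\<close> and \<open>d\<close> allows
  \<open>c\<close> to be replaced by \<open>d\<close> through conjugation with
  \<open>cyc3 c d e\<close>. If \<open>e\<close> is \<open>a\<close> or \<open>b\<close>,
  conjugation with the inverse cycle yields a three-cycle on \<open>a\<close>, \<open>b\<close>,
  \<open>d\<close> instead.\<close>

lemma cyc3_mem_of_linked:
  assumes G: "perm_closed G"
    and linked: "\<And>a b. a \<in> \<Omega> \<Longrightarrow> b \<in> \<Omega> \<Longrightarrow> cyc3_linked G a b"
    and sub: "G \<subseteq> perms_on \<Omega>"
    and abd: "a \<in> \<Omega>" "b \<in> \<Omega>" "d \<in> \<Omega>" "distinct [a, b, d]"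
  shows "cyc3 a b d \<in> G"
proof -
  obtain c where c: "distinct [a, b, c]" "cyc3 a b c \<in> G"
    using linked[of a b] abd by (auto simp: cyc3_linked_def)
  show ?thesis
  proof (cases "c = d")
    case True
    then show ?thesis using c by simp
  next
    case False
    have "c \<in> \<Omega>"
      using c sub affected_cyc3[OF c(1)] by (auto simp: perms_on_def)
    then obtain e where e: "distinct [c, d, e]" "cyc3 c d e \<in> G"
      using linked[of c d] abd False by (auto simp: cyc3_linked_def)
    note conj = cyc3_conj_mem[OF G c e(2)] and inv = cyc3_conj_mem[OF G c cyc3_closed(5)[OF G e]]
    consider "e = a" | "e = b" | "e \<noteq> a" "e \<noteq> b" by blast
    then show ?thesis
    proof cases
      case 1
      with inv have "cyc3 d b a \<in> G"
        using e c abd by (auto simp: apply_cyc3)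
      then show ?thesis
        using cyc3_closed(5)[OF G, of d b a] abd by auto
    next
      case 2
      with inv have "cyc3 a d b \<in> G"
        using e c abd by (auto simp: apply_cyc3)
      then show ?thesis
        using cyc3_closed(4)[OF G, of a d b] abd by auto
    next
      case 3
      with conj show ?thesis
        using e c abd by (auto simp: apply_cyc3)
    qed
  qed
qed

text \<open>The supports of \<open>f\<close> and \<open>h\<close> meet in \<open>q\<close> alone.
  Hence \<open>h\<close> fixes the image of \<open>q\<close> under \<open>f\<close>, and
  \<open>f\<close> fixes the image of \<open>q\<close> under \<open>h\<close>.\<close>

lemma commutator_cyc3:
  assumes f: "f \<langle>$\<rangle> q \<noteq> q" and h: "h \<langle>$\<rangle> q \<noteq> q"
    and supp: "\<And>x. x \<noteq> q \<Longrightarrow> f \<langle>$\<rangle> x = x \<or> h \<langle>$\<rangle> x = x"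
  shows "distinct [q, f \<langle>$\<rangle> q, h \<langle>$\<rangle> q]"
    and "f * h * inverse f * inverse h = cyc3 q (f \<langle>$\<rangle> q) (h \<langle>$\<rangle> q)"
proof -
  have hf: "h \<langle>$\<rangle> (f \<langle>$\<rangle> q) = f \<langle>$\<rangle> q"
    using supp[of "f \<langle>$\<rangle> q"] f by (auto simp: apply_inj)
  have fh: "f \<langle>$\<rangle> (h \<langle>$\<rangle> q) = h \<langle>$\<rangle> q"
    using supp[of "h \<langle>$\<rangle> q"] h by (auto simp: apply_inj)
  show d: "distinct [q, f \<langle>$\<rangle> q, h \<langle>$\<rangle> q]"
    using f h hf by (metis apply_inj distinct_length_2_or_more distinct_singleton)
  \<comment> \<open>Without inverses the identity can be compared pointwise: the two orders of
    composition differ only at \<open>q\<close> and at its preimages under \<open>f\<close> and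
    \<open>h\<close>.\<close>
  have "f * h = cyc3 q (f \<langle>$\<rangle> q) (h \<langle>$\<rangle> q) * (h * f)"
  proof (rule perm_eqI)
    fix x
    consider "x = q" | "f \<langle>$\<rangle> x = q" "x \<noteq> q" | "h \<langle>$\<rangle> x = q" "x \<noteq> q"
      | "x \<noteq> q" "f \<langle>$\<rangle> x \<noteq> q" "h \<langle>$\<rangle> x \<noteq> q"
      by blast
    then show "(f * h) \<langle>$\<rangle> x = (cyc3 q (f \<langle>$\<rangle> q) (h \<langle>$\<rangle> q) * (h * f)) \<langle>$\<rangle> x"
    proof cases
      case 1
      then show ?thesis
        using d hf fh by (auto simp: apply_times apply_cyc3)
    next
      case 2
      then have "h \<langle>$\<rangle> x = x"
        using supp by metis
      with 2 show ?thesis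
        using d by (auto simp: apply_times apply_cyc3)
    next
      case 3
      then have "f \<langle>$\<rangle> x = x"
        using supp by metis
      with 3 show ?thesis
        using d by (auto simp: apply_times apply_cyc3)
    next
      case 4
      have "f \<langle>$\<rangle> x = x \<or> h \<langle>$\<rangle> x = x" "f \<langle>$\<rangle> (h \<langle>$\<rangle> x) = h \<langle>$\<rangle> x \<or> h \<langle>$\<rangle> x = x"
        "h \<langle>$\<rangle> (f \<langle>$\<rangle> x) = f \<langle>$\<rangle> x \<or> f \<langle>$\<rangle> x = x"
        using supp 4 by (metis apply_inj)+
      then show ?thesis
        using d 4 by (auto simp: apply_times apply_cyc3 apply_inj)
    qed
  qed
  then show "f * h * inverse f * inverse h = cyc3 q (f \<langle>$\<rangle> q) (h \<langle>$\<rangle> q)"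
    by (simp add: mult.assoc)
qed

section \<open>Alternating groups\<close>

text \<open>For finite \<Omega> this is the alternating group, given by generators instead of
  parity, so that inclusions and invariance are tested on three-cycles.\<close>

definition alt_perms :: "'a set \<Rightarrow> 'a perm set" where
  "alt_perms \<Omega> = perm_span {cyc3 a b c | a b c. {a, b, c} \<subseteq> \<Omega> \<and> distinct [a, b, c]}"

lemma perm_closed_alt_perms: "perm_closed (alt_perms \<Omega>)"
  unfolding alt_perms_def by (rule perm_closed_perm_span)

lemma cyc3_mem_alt_perms:
  "a \<in> \<Omega> \<Longrightarrow> b \<in> \<Omega> \<Longrightarrow> c \<in> \<Omega> \<Longrightarrow> distinct [a, b, c] \<Longrightarrow> cyc3 a b c \<in> alt_perms \<Omega>"
  unfolding alt_perms_def by (rule subsetD[OF perm_span_superset]) blast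

lemma alt_perms_subset:
  assumes "perm_closed G"
    and "\<And>a b c. a \<in> \<Omega> \<Longrightarrow> b \<in> \<Omega> \<Longrightarrow> c \<in> \<Omega> \<Longrightarrow> distinct [a, b, c] \<Longrightarrow> cyc3 a b c \<in> G"
  shows "alt_perms \<Omega> \<subseteq> G"
  unfolding alt_perms_def using assms by (intro perm_span_least) auto

lemma alt_perms_subset_perms_on: "alt_perms \<Omega> \<subseteq> perms_on \<Omega>"
  by (rule alt_perms_subset[OF perm_closed_perms_on]) (simp only: perms_on_def mem_Collect_eq affected_cyc3, simp)

lemma alt_perms_conj:
  assumes g: "g \<in> perms_on \<Omega>" and x: "x \<in> alt_perms \<Omega>"
  shows "g * x * inverse g \<in> alt_perms \<Omega>"
proof -
  have "alt_perms \<Omega> \<subseteq> {x. g * x * inverse g \<in> alt_perms \<Omega>}"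
  proof (rule alt_perms_subset)
    show "perm_closed {x. g * x * inverse g \<in> alt_perms \<Omega>}"
      by (rule perm_closed_conj_vimage[OF perm_closed_alt_perms])
    fix a b c assume *: "a \<in> \<Omega>" "b \<in> \<Omega>" "c \<in> \<Omega>" "distinct [a, b, c]"
    then have "cyc3 (g \<langle>$\<rangle> a) (g \<langle>$\<rangle> b) (g \<langle>$\<rangle> c) \<in> alt_perms \<Omega>"
      using g by (intro cyc3_mem_alt_perms) (auto simp: perms_on_apply_iff apply_inj)
    then show "cyc3 a b c \<in> {x. g * x * inverse g \<in> alt_perms \<Omega>}"
      by (simp only: mem_Collect_eq conj_cyc3[OF *(4)])
  qed
  with x show ?thesis by blast
qed

section \<open>Simplicity of the alternating groups\<close>

lemma ex_new_element:
  assumes "finite \<Omega>" "card \<Omega> \<ge> 5" "length xs < 5"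
  obtains e where "e \<in> \<Omega>" "e \<notin> set xs"
proof -
  have "\<not> \<Omega> \<subseteq> set xs"
  proof
    assume "\<Omega> \<subseteq> set xs"
    then have "card \<Omega> \<le> card (set xs)"
      by (simp add: card_mono)
    also have "\<dots> \<le> length xs"
      by (rule card_length)
    finally show False
      using assms by simp
  qed
  then show ?thesis
    using that by blast
qed

text \<open>
  Every case takes commutators \<open>[g, t]\<close> with a suitable three-cycle \<open>t\<close>; each is a product of two
  three-cycles, hence moves few points.
\<close>

lemma normal_contains_cyc3:
  assumes \<Omega>: "finite \<Omega>" "card \<Omega> \<ge> 5"
    and N: "perm_closed N" "N \<subseteq> perms_on \<Omega>"
    and conj: "\<And>a b c n. {a, b, c} \<subseteq> \<Omega> \<Longrightarrow> distinct [a, b, c] \<Longrightarrow> n \<in> N \<Longrightarrow>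
                 cyc3 a b c * n * inverse (cyc3 a b c) \<in> N"
    and g: "g \<in> N" "g \<noteq> 1"
  obtains a b c where "{a, b, c} \<subseteq> \<Omega>" "distinct [a, b, c]" "cyc3 a b c \<in> N"
proof -
  let ?goal = "\<exists>a b c. {a, b, c} \<subseteq> \<Omega> \<and> distinct [a, b, c] \<and> cyc3 a b c \<in> N"
  \<comment> \<open>Only conjugation by three-cycles is assumed to preserve \<open>N\<close>, so the
    commutator is grouped as \<open>h\<close> times a conjugate of \<open>inverse h\<close>.\<close>
  have comm: "cyc3 (h \<langle>$\<rangle> a) (h \<langle>$\<rangle> b) (h \<langle>$\<rangle> c) * cyc3 b a c \<in> N"
    if "h \<in> N" "{a, b, c} \<subseteq> \<Omega>" "distinct [a, b, c]" for h a b c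
  proof -
    have "cyc3 a b c * inverse h * inverse (cyc3 a b c) \<in> N"
      using that by (intro conj perm_closedD(3)[OF N(1)])
    with that(1) have "h * (cyc3 a b c * inverse h * inverse (cyc3 a b c)) \<in> N"
      by (rule perm_closedD(2)[OF N(1)])
    moreover have "h * (cyc3 a b c * inverse h * inverse (cyc3 a b c)) =
        h * cyc3 a b c * inverse h * inverse (cyc3 a b c)"
      by (simp only: mult.assoc)
    ultimately show ?thesis
      by (simp only: inverse_cyc3[OF that(3)] conj_cyc3[OF that(3)])
  qed
  have mem: "h \<langle>$\<rangle> x \<in> \<Omega> \<longleftrightarrow> x \<in> \<Omega>" if "h \<in> N" for h x
    using that N(2) by (intro perms_on_apply_iff) blast
  \<comment> \<open>Here the commutator is the square of \<open>cyc3 b a e\<close>, which is its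
    inverse.\<close>
  have swap: ?goal
    if h: "h \<in> N" and abe: "{a, b, e} \<subseteq> \<Omega>" "distinct [a, b, e]"
      and "h \<langle>$\<rangle> a = b" "h \<langle>$\<rangle> b = a" "h \<langle>$\<rangle> e = e" for h a b e
  proof -
    have "cyc3 b a e * cyc3 b a e \<in> N"
      using comm[OF h abe] that by simp
    moreover have "cyc3 b a e * cyc3 b a e = cyc3 a b e"
      using abe by (intro perm_eqI) (auto simp: apply_times apply_cyc3)
    ultimately show ?thesis
      using abe by metis
  qed
  \<comment> \<open>Along four consecutive points of a cycle of \<open>h\<close>, the two
    three-cycles of the commutator cancel at \<open>c\<close>, and a single three-cycle
    remains.\<close>
  have path: ?goal
    if h: "h \<in> N" and abcd: "{a, b, c, d} \<subseteq> \<Omega>" "distinct [a, b, c, d]"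
      and "h \<langle>$\<rangle> a = b" "h \<langle>$\<rangle> b = c" "h \<langle>$\<rangle> c = d" for h a b c d
  proof -
    have "cyc3 b c d * cyc3 b a c \<in> N"
      using comm[OF h, of a b c] that by simp
    moreover have "cyc3 b c d * cyc3 b a c = cyc3 a d b"
      using abcd by (intro perm_eqI) (auto simp: apply_times apply_cyc3)
    moreover have "{a, d, b} \<subseteq> \<Omega>" "distinct [a, d, b]"
      using abcd by auto
    ultimately show ?thesis
      by metis
  qed
  obtain a where a: "g \<langle>$\<rangle> a \<noteq> a"
    using g(2) by (metis affected_empty_iff all_not_in_conv in_affected)
  obtain b p where gab: "g \<langle>$\<rangle> a = b" and gbp: "g \<langle>$\<rangle> b = p"
    by blast
  have ab: "a \<in> \<Omega>" "b \<in> \<Omega>" "a \<noteq> b"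
    using a gab g(1) N(2) mem[OF g(1), of a] perms_onD[of g \<Omega> a] by auto
  have p: "p \<in> \<Omega>" "p \<noteq> b"
    using ab mem[OF g(1), of b] gbp gab by (auto, metis apply_inj)
  \<comment> \<open>The cases are, in this order, cycles of \<open>g\<close> through
    \<open>a\<close> of length two, at least four, and three. Where neither \<open>swap\<close> nor
    \<open>path\<close> is applied to \<open>g\<close> itself, it is applied to the commutator
    \<open>k\<close> of \<open>g\<close> with \<open>cyc3 a b c\<close>.\<close>
  have ?goal
  proof (cases "p = a")
    case True
    obtain c where c: "c \<in> \<Omega>" "c \<notin> set [a, b]"
      using ex_new_element[OF \<Omega>, of "[a, b]"] by auto
    obtain d where gcd: "g \<langle>$\<rangle> c = d"
      by blast
    have "d \<noteq> g \<langle>$\<rangle> b" "d \<noteq> g \<langle>$\<rangle> a"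
      using c unfolding gcd[symmetric] apply_inj by auto
    then have d: "d \<in> \<Omega>" "d \<noteq> a" "d \<noteq> b"
      using c mem[OF g(1), of c] gcd gab gbp True by auto
    have k: "cyc3 b a d * cyc3 b a c \<in> N"
      using comm[OF g(1), of a b c] gab gbp gcd True ab c by auto
    show ?thesis
    proof (cases "d = c")
      case True
      with swap[OF g(1), of a b c] show ?thesis
        using \<open>p = a\<close> ab c gab gbp gcd by auto
    next
      case False
      obtain e where e: "e \<in> \<Omega>" "e \<notin> set [a, b, c, d]"
        using ex_new_element[OF \<Omega>, of "[a, b, c, d]"] by auto
      show ?thesis
      proof (rule swap[OF k, of a c e])
      qed (use ab c d e False in \<open>auto simp: apply_times apply_cyc3\<close>)
    qed
  next
    case False
    show ?thesis
    proof (cases "g \<langle>$\<rangle> p = a")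
      case neq: False
      have "g \<langle>$\<rangle> p \<noteq> g \<langle>$\<rangle> a" "g \<langle>$\<rangle> p \<noteq> g \<langle>$\<rangle> b"
        using False p unfolding apply_inj by auto
      then have "distinct [a, b, p, g \<langle>$\<rangle> p]"
        using neq False ab p gab gbp by auto
      with path[OF g(1), of a b p "g \<langle>$\<rangle> p"] show ?thesis
        using ab p mem[OF g(1), of p] gab gbp by auto
    next
      case True
      obtain c where c: "c \<in> \<Omega>" "c \<notin> set [a, b, p]"
        using ex_new_element[OF \<Omega>, of "[a, b, p]"] by auto
      obtain d where gcd: "g \<langle>$\<rangle> c = d"
        by blast
      have "d \<noteq> g \<langle>$\<rangle> b" "d \<noteq> g \<langle>$\<rangle> a" "d \<noteq> g \<langle>$\<rangle> p"
        using c unfolding gcd[symmetric] apply_inj by auto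
      then have d: "d \<in> \<Omega>" "d \<noteq> a" "d \<noteq> b" "d \<noteq> p"
        using c mem[OF g(1), of c] True gab gbp gcd by auto
      have k: "cyc3 b p d * cyc3 b a c \<in> N"
        using comm[OF g(1), of a b c] gab gbp gcd ab c by auto
      show ?thesis
      proof (cases "d = c")
        case True
        obtain e where e: "e \<in> \<Omega>" "e \<notin> set [a, b, c, p]"
          using ex_new_element[OF \<Omega>, of "[a, b, c, p]"] by auto
        show ?thesis
        proof (rule swap[OF k, of a b e])
        qed (use True False ab c d e p in \<open>auto simp: apply_times apply_cyc3\<close>)
      next
        case neq: False
        show ?thesis
        proof (rule path[OF k, of a c p d])
        qed (use neq False ab c d p in \<open>auto simp: apply_times apply_cyc3\<close>)
      qed
    qed
  qed
  with that show thesis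
    by blast
qed

text \<open>One three-cycle in \<open>N\<close> links \<open>a\<close> and \<open>b\<close>.
  Conjugation by \<open>cyc3 b x e\<close>, with \<open>e\<close> chosen so that \<open>a\<close> is
  fixed, moves this link to \<open>a\<close> and \<open>x\<close>; hence all points are linked and
  every three-cycle lies in \<open>N\<close>.\<close>

lemma alt_perms_subset_normal:
  assumes \<Omega>: "finite \<Omega>" "card \<Omega> \<ge> 5"
    and N: "perm_closed N" "N \<subseteq> perms_on \<Omega>"
    and conj: "\<And>a b c n. {a, b, c} \<subseteq> \<Omega> \<Longrightarrow> distinct [a, b, c] \<Longrightarrow> n \<in> N \<Longrightarrow>
                 cyc3 a b c * n * inverse (cyc3 a b c) \<in> N"
    and g: "g \<in> N" "g \<noteq> 1"
  shows "alt_perms \<Omega> \<subseteq> N"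
proof -
  obtain a b c where abc: "{a, b, c} \<subseteq> \<Omega>" "distinct [a, b, c]" "cyc3 a b c \<in> N"
    using normal_contains_cyc3[OF \<Omega> N _ g] conj by blast
  have ab: "cyc3_linked N a b"
    using cyc3_linkedI[OF N(1) abc(2,3)] by blast
  have linked: "cyc3_linked N a x" if "x \<in> \<Omega>" for x
  proof (cases "x = a \<or> x = b")
    case True
    then show ?thesis
      using ab by (auto simp: cyc3_linked_def)
  next
    case False
    obtain e where e: "e \<in> \<Omega>" "e \<notin> set [a, b, x]"
      using ex_new_element[OF \<Omega>, of "[a, b, x]"] by auto
    have d: "distinct [b, x, e]"
      using False e by auto
    have "cyc3_linked N (cyc3 b x e \<langle>$\<rangle> a) (cyc3 b x e \<langle>$\<rangle> b)"
      using ab that e abc False d by (intro cyc3_linked_image[OF N(1)] conj) auto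
    then show ?thesis
      using False e abc by (auto simp: apply_cyc3)
  qed
  have all: "cyc3_linked N x y" if "x \<in> \<Omega>" "y \<in> \<Omega>" for x y
    using that linked cyc3_linked_sym[OF N(1)] cyc3_linked_trans[OF N(1)] by blast
  show ?thesis
    using cyc3_mem_of_linked[OF N(1) all N(2)] by (intro alt_perms_subset[OF N(1)])
qed

lemma obtain_four:
  assumes \<Omega>: "finite \<Omega>" "card \<Omega> \<ge> 5"
  obtains a b c d where "{a, b, c, d} \<subseteq> \<Omega>" "distinct [a, b, c, d]"
proof -
  obtain a where a: "a \<in> \<Omega>" "a \<notin> set []"
    using ex_new_element[OF \<Omega>, of "[]"] by auto
  obtain b where b: "b \<in> \<Omega>" "b \<notin> set [a]"
    using ex_new_element[OF \<Omega>, of "[a]"] by auto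
  obtain c where c: "c \<in> \<Omega>" "c \<notin> set [a, b]"
    using ex_new_element[OF \<Omega>, of "[a, b]"] by auto
  obtain d where d: "d \<in> \<Omega>" "d \<notin> set [a, b, c]"
    using ex_new_element[OF \<Omega>, of "[a, b, c]"] by auto
  show ?thesis
    using that[of a b c d] a b c d by auto
qed

lemma simple_alt_perms:
  assumes \<Omega>: "finite \<Omega>" "card \<Omega> \<ge> 5"
  shows "simple_group (perm_monoid (alt_perms \<Omega>))" "\<not> comm_group (perm_monoid (alt_perms \<Omega>))"
proof -
  let ?A = "perm_monoid (alt_perms \<Omega>)"
  interpret group ?A
    by (rule group_perm_monoid[OF perm_closed_alt_perms])
  obtain a b c d where abcd: "{a, b, c, d} \<subseteq> \<Omega>" "distinct [a, b, c, d]"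
    using obtain_four[OF \<Omega>] .
  have mem: "cyc3 a b c \<in> alt_perms \<Omega>" "cyc3 a b d \<in> alt_perms \<Omega>"
    using abcd by (auto intro: cyc3_mem_alt_perms)
  have fin: "finite (alt_perms \<Omega>)"
    using finite_perms_on[OF \<Omega>(1)] alt_perms_subset_perms_on finite_subset by blast
  have "cyc3 a b c \<langle>$\<rangle> a \<noteq> 1 \<langle>$\<rangle> a"
    using abcd by (auto simp: apply_cyc3)
  then have "1 \<noteq> cyc3 a b c"
    by metis
  then have "card {1, cyc3 a b c} = 2" "{1, cyc3 a b c} \<subseteq> alt_perms \<Omega>"
    using mem perm_closedD(1)[OF perm_closed_alt_perms] by auto
  then have "Coset.order ?A > 1"
    using card_mono[OF fin, of "{1, cyc3 a b c}"] by (simp add: Coset.order_def)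
  moreover have "N = alt_perms \<Omega> \<or> N = {1}" if "N \<lhd> ?A" for N
  proof (rule disjCI)
    assume "N \<noteq> {1}"
    interpret N: normal N ?A by fact
    have sub: "N \<subseteq> alt_perms \<Omega>"
      using N.subset by simp
    have closed: "perm_closed N"
      unfolding perm_closed_def
    proof (intro conjI ballI)
      show "g * h \<in> N" if "g \<in> N" "h \<in> N" for g h
        using N.m_closed that by auto
      show "inverse g \<in> N" if "g \<in> N" for g
        using N.m_inv_closed[OF that] inv_perm_monoid[OF perm_closed_alt_perms subsetD[OF sub that]]
        by metis
    qed (use N.one_closed in auto)
    moreover obtain g where "g \<in> N" "g \<noteq> 1"
      using \<open>N \<noteq> {1}\<close> closed by (auto simp: perm_closed_def)
    moreover have "x * n * inverse x \<in> N" if "x \<in> alt_perms \<Omega>" "n \<in> N" for x n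
      using N.inv_op_closed2[of x n] that by (simp add: inv_perm_monoid[OF perm_closed_alt_perms])
    moreover have "N \<subseteq> perms_on \<Omega>"
      using sub alt_perms_subset_perms_on by blast
    ultimately have "alt_perms \<Omega> \<subseteq> N"
      by (intro alt_perms_subset_normal[OF \<Omega>, of N g]) (simp_all add: cyc3_mem_alt_perms)
    with sub show "N = alt_perms \<Omega>" by simp
  qed
  ultimately show "simple_group ?A"
    by unfold_locales auto
  have "(cyc3 a b c * cyc3 a b d) \<langle>$\<rangle> a \<noteq> (cyc3 a b d * cyc3 a b c) \<langle>$\<rangle> a"
    using abcd by (auto simp: apply_times apply_cyc3)
  then have "cyc3 a b c * cyc3 a b d \<noteq> cyc3 a b d * cyc3 a b c"
    by metis
  then show "\<not> comm_group ?A"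
    using mem comm_monoid.m_comm[of ?A "cyc3 a b c" "cyc3 a b d"] by (auto simp: comm_group_def)
qed

text \<open>If \<open>g\<close> moves \<open>a\<close> to \<open>b\<close> and \<open>c\<close>,
  \<open>d\<close> are two further points, then \<open>cyc3 a c d\<close> fixes \<open>b\<close>,
  whereas its conjugate by \<open>g\<close> moves \<open>b\<close>.\<close>

lemma alt_perms_centraliser_trivial:
  assumes \<Omega>: "finite \<Omega>" "card \<Omega> \<ge> 5" and g: "g \<in> perms_on \<Omega>"
    and comm: "\<And>x. x \<in> alt_perms \<Omega> \<Longrightarrow> g * x * inverse g = x"
  shows "g = 1"
proof (rule ccontr)
  assume "g \<noteq> 1"
  then obtain a where a: "g \<langle>$\<rangle> a \<noteq> a"
    by (metis affected_empty_iff all_not_in_conv in_affected)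
  define b where "b = g \<langle>$\<rangle> a"
  have "a \<in> \<Omega>"
    using a g perms_onD by metis
  obtain c where c: "c \<in> \<Omega>" "c \<notin> set [a, b]"
    using ex_new_element[OF \<Omega>, of "[a, b]"] by auto
  obtain d where d: "d \<in> \<Omega>" "d \<notin> set [a, b, c]"
    using ex_new_element[OF \<Omega>, of "[a, b, c]"] by auto
  have dist: "distinct [a, c, d]"
    using c d by auto
  have "cyc3 (g \<langle>$\<rangle> a) (g \<langle>$\<rangle> c) (g \<langle>$\<rangle> d) = cyc3 a c d"
    using comm[of "cyc3 a c d"] conj_cyc3[OF dist, of g] \<open>a \<in> \<Omega>\<close> c(1) d(1) dist
    by (simp add: cyc3_mem_alt_perms)
  moreover have "cyc3 (g \<langle>$\<rangle> a) (g \<langle>$\<rangle> c) (g \<langle>$\<rangle> d) \<langle>$\<rangle> b \<noteq> b"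
    using dist by (subst apply_cyc3) (auto simp: b_def apply_inj)
  moreover have "cyc3 a c d \<langle>$\<rangle> b = b"
    using c d a dist by (auto simp: apply_cyc3 b_def)
  ultimately show False
    by simp
qed

section \<open>A criterion for almost simple groups\<close>

text \<open>This serves \<open>almost_simple\<close>, whose simple group has natural numbers as
  elements.\<close>

lemma finite_group_iso_nat:
  fixes G :: "('a, 'b) monoid_scheme"
  assumes "group G" "finite (carrier G)"
  obtains T :: "nat monoid" and \<phi> where "group T" "\<phi> \<in> iso G T"
proof -
  interpret group G by fact
  obtain \<phi> :: "'a \<Rightarrow> nat" where inj: "inj_on \<phi> (carrier G)"
    using finite_imp_inj_to_nat_seg[OF assms(2)] by auto
  define inv\<phi> where "inv\<phi> = inv_into (carrier G) \<phi>"
  have inv\<phi> [simp]: "inv\<phi> (\<phi> x) = x" if "x \<in> carrier G" for x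
    using inj that by (simp add: inv\<phi>_def)
  define T :: "nat monoid" where
    "T = \<lparr>carrier = \<phi> ` carrier G, monoid.mult = \<lambda>x y. \<phi> (inv\<phi> x \<otimes>\<^bsub>G\<^esub> inv\<phi> y), one = \<phi> \<one>\<^bsub>G\<^esub>\<rparr>"
  have \<phi>: "\<phi> \<in> iso G T"
    using inj by (auto simp: T_def iso_def hom_def bij_betw_def)
  \<comment> \<open>\<open>iso_imp_img_group\<close> delivers a group whose unit field is
    overwritten by the image of the unit; here that is the unit which \<open>T\<close> already
    has.\<close>
  have "T\<lparr>one := \<phi> \<one>\<^bsub>G\<^esub>\<rparr> = T"
    by (simp add: T_def)
  then have "group T"
    using iso_imp_img_group[OF \<phi>] by simp
  with \<phi> show ?thesis
    using that by blast
qed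

text \<open>\<open>G\<close> acts on the normal subgroup \<open>N\<close> by conjugation. The kernel
  of this action is the centraliser of \<open>N\<close>, so \<open>G\<close> embeds in the
  automorphism group, and the elements of \<open>N\<close> itself induce the inner
  automorphisms.\<close>

lemma almost_simpleI:
  fixes G :: "('a, 'b) monoid_scheme"
  assumes fin: "finite (carrier G)" and normal: "N \<lhd> G"
    and simple: "simple_group (G\<lparr>carrier := N\<rparr>)" and ncomm: "\<not> comm_group (G\<lparr>carrier := N\<rparr>)"
    and centraliser: "\<And>g. g \<in> carrier G \<Longrightarrow> (\<forall>x\<in>N. g \<otimes>\<^bsub>G\<^esub> x \<otimes>\<^bsub>G\<^esub> inv\<^bsub>G\<^esub> g = x) \<Longrightarrow> g = \<one>\<^bsub>G\<^esub>"
  shows "almost_simple G"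
proof -
  interpret N: normal N G by fact
  have NG: "x \<in> carrier G" if "x \<in> N" for x
    using that N.subset by blast
  have finN: "finite N"
    using fin N.subset finite_subset by blast
  obtain T :: "nat monoid" and \<phi> where T: "group T" and \<phi>: "\<phi> \<in> iso (G\<lparr>carrier := N\<rparr>) T"
    using finite_group_iso_nat[of "G\<lparr>carrier := N\<rparr>"] simple finN
    by (auto simp: simple_group_def)
  interpret T: group T by fact
  have bij: "bij_betw \<phi> N (carrier T)"
    using \<phi> by (simp add: iso_def)
  have \<phi>_mult: "\<phi> (x \<otimes>\<^bsub>G\<^esub> y) = \<phi> x \<otimes>\<^bsub>T\<^esub> \<phi> y" if "x \<in> N" "y \<in> N" for x y
    using \<phi> that by (auto simp: iso_def hom_def)
  have \<phi>_mem: "\<phi> x \<in> carrier T" if "x \<in> N" for x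
    using bij that by (auto simp: bij_betw_def)
  have \<phi>_surj: "\<exists>x\<in>N. t = \<phi> x" if "t \<in> carrier T" for t
    using bij that by (auto simp: bij_betw_def)
  define c where "c g x = g \<otimes>\<^bsub>G\<^esub> x \<otimes>\<^bsub>G\<^esub> inv\<^bsub>G\<^esub> g" for g x
  have c_mem: "c g x \<in> N" if "g \<in> carrier G" "x \<in> N" for g x
    using that by (simp add: c_def N.inv_op_closed2)
  have c_mult: "c g (x \<otimes>\<^bsub>G\<^esub> y) = c g x \<otimes>\<^bsub>G\<^esub> c g y" if "g \<in> carrier G" "x \<in> N" "y \<in> N" for g x y
    using that NG by (simp add: c_def N.m_assoc N.inv_solve_left)
  have c_comp: "c (g \<otimes>\<^bsub>G\<^esub> h) x = c g (c h x)" if "g \<in> carrier G" "h \<in> carrier G" "x \<in> N" for g h x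
    using that NG by (simp add: c_def N.m_assoc N.inv_mult_group)
  have c_one: "c \<one>\<^bsub>G\<^esub> x = x" if "x \<in> N" for x
    using that NG by (simp add: c_def)
  \<comment> \<open>Conjugation by \<open>g\<close>, carried over from \<open>N\<close> to
    \<open>T\<close>; the restriction to the carrier makes it an element of
    \<open>Bij\<close>.\<close>
  define \<gamma> where "\<gamma> g = (\<lambda>t\<in>carrier T. \<phi> (c g (inv_into N \<phi> t)))" for g
  have \<gamma>: "\<gamma> g (\<phi> x) = \<phi> (c g x)" if "x \<in> N" for g x
    using that bij \<phi>_mem by (simp add: \<gamma>_def bij_betw_inv_into_left)
  have \<gamma>_comp: "\<gamma> g (\<gamma> h t) = \<gamma> (g \<otimes>\<^bsub>G\<^esub> h) t" 
    if "g \<in> carrier G" "h \<in> carrier G" "t \<in> carrier T" for g h t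
    using \<phi>_surj[OF that(3)] that by (auto simp: \<gamma> c_mem c_comp)
  have \<gamma>_mem: "\<gamma> g t \<in> carrier T" if "g \<in> carrier G" "t \<in> carrier T" for g t
    using \<phi>_surj[OF that(2)] that by (auto simp: \<gamma> c_mem \<phi>_mem)
  have \<gamma>_one: "\<gamma> \<one>\<^bsub>G\<^esub> t = t" if "t \<in> carrier T" for t
    using \<phi>_surj[OF that] by (auto simp: \<gamma> c_one)
  have \<gamma>_Bij: "\<gamma> g \<in> Bij (carrier T)" if "g \<in> carrier G" for g
  proof -
    have "bij_betw (\<gamma> g) (carrier T) (carrier T)"
      using that by (intro bij_betw_byWitness[where f' = "\<gamma> (inv\<^bsub>G\<^esub> g)"])
        (auto simp: \<gamma>_comp \<gamma>_mem \<gamma>_one)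
    then show ?thesis
      by (simp add: Bij_def \<gamma>_def)
  qed
  have \<gamma>_auto: "\<gamma> g \<in> auto T" if g: "g \<in> carrier G" for g
  proof -
    have "\<gamma> g (s \<otimes>\<^bsub>T\<^esub> t) = \<gamma> g s \<otimes>\<^bsub>T\<^esub> \<gamma> g t" if st: "s \<in> carrier T" "t \<in> carrier T" for s t
    proof -
      obtain x y where xy: "x \<in> N" "y \<in> N" "s = \<phi> x" "t = \<phi> y"
        using \<phi>_surj st by metis
      then have "\<gamma> g (s \<otimes>\<^bsub>T\<^esub> t) = \<phi> (c g (x \<otimes>\<^bsub>G\<^esub> y))"
        using \<gamma>[of "x \<otimes>\<^bsub>G\<^esub> y"] by (simp add: \<phi>_mult)
      then show ?thesis
        using xy g by (simp add: \<gamma> c_mult \<phi>_mult c_mem)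
    qed
    then show ?thesis
      using g \<gamma>_mem \<gamma>_Bij by (auto simp: auto_def hom_def)
  qed
  interpret \<gamma>: group_hom G "AutoGroup T" \<gamma>
  proof (intro group_hom.intro group_hom_axioms.intro homI)
    show "group G" "group (AutoGroup T)"
      by (rule N.is_group, rule T.AutoGroup)
    show "\<gamma> g \<in> carrier (AutoGroup T)" if "g \<in> carrier G" for g
      using that \<gamma>_auto by (simp add: AutoGroup_def)
    show "\<gamma> (g \<otimes>\<^bsub>G\<^esub> h) = \<gamma> g \<otimes>\<^bsub>AutoGroup T\<^esub> \<gamma> h" if "g \<in> carrier G" "h \<in> carrier G" for g h
    proof (rule ext)
      fix t
      have "\<gamma> (g \<otimes>\<^bsub>G\<^esub> h) t = undefined" if "t \<notin> carrier T"
        using that by (simp add: \<gamma>_def)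
      then show "\<gamma> (g \<otimes>\<^bsub>G\<^esub> h) t = (\<gamma> g \<otimes>\<^bsub>AutoGroup T\<^esub> \<gamma> h) t"
        using that by (simp add: AutoGroup_def BijGroup_def \<gamma>_Bij compose_def \<gamma>_comp)
    qed
  qed
  define H where "H = \<gamma> ` carrier G"
  have "inj_on \<gamma> (carrier G)"
  proof (rule \<gamma>.inj_on_one_iff[THEN iffD2], intro allI impI)
    fix g assume g: "g \<in> carrier G" "\<gamma> g = \<one>\<^bsub>AutoGroup T\<^esub>"
    have "c g x = x" if "x \<in> N" for x
    proof -
      have "\<phi> (c g x) = \<phi> x"
        using that g \<gamma>[of x g] \<phi>_mem by (simp add: AutoGroup_def BijGroup_def)
      then show ?thesis
        using that g bij c_mem by (auto simp: bij_betw_def inj_on_def)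
    qed
    then show "g = \<one>\<^bsub>G\<^esub>"
      using centraliser g by (simp add: c_def)
  qed
  then have "\<gamma> \<in> iso G (AutoGroup T\<lparr>carrier := H\<rparr>)"
    using \<gamma>.homh by (auto simp: iso_def bij_betw_def H_def hom_def)
  then have "G \<cong> AutoGroup T\<lparr>carrier := H\<rparr>"
    by (auto simp: is_iso_def)
  moreover have "subgroup H (AutoGroup T)"
    unfolding H_def by (rule \<gamma>.img_is_subgroup)
  moreover have "inner_autos T \<subseteq> H"
  proof
    fix \<alpha> assume "\<alpha> \<in> inner_autos T"
    then obtain x where x: "x \<in> N" and \<alpha>: "\<alpha> = (\<lambda>t\<in>carrier T. \<phi> x \<otimes>\<^bsub>T\<^esub> t \<otimes>\<^bsub>T\<^esub> inv\<^bsub>T\<^esub> \<phi> x)"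
      using \<phi>_surj by (auto simp: inner_autos_def)
    have inv: "\<phi> (inv\<^bsub>G\<^esub> x) = inv\<^bsub>T\<^esub> \<phi> x"
    proof (rule T.inv_equality[symmetric])
      have "\<phi> \<one>\<^bsub>G\<^esub> \<otimes>\<^bsub>T\<^esub> \<phi> \<one>\<^bsub>G\<^esub> = \<phi> \<one>\<^bsub>G\<^esub>"
        using \<phi>_mult[of "\<one>\<^bsub>G\<^esub>" "\<one>\<^bsub>G\<^esub>"] by simp
      then have "\<phi> \<one>\<^bsub>G\<^esub> = \<one>\<^bsub>T\<^esub>"
        using \<phi>_mem[of "\<one>\<^bsub>G\<^esub>"] by (simp add: T.l_cancel_one')
      then show "\<phi> (inv\<^bsub>G\<^esub> x) \<otimes>\<^bsub>T\<^esub> \<phi> x = \<one>\<^bsub>T\<^esub>"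
        using x NG \<phi>_mult[of "inv\<^bsub>G\<^esub> x" x] by simp
    qed (use x \<phi>_mem in auto)
    have "\<alpha> = \<gamma> x"
    proof (rule ext)
      fix t
      show "\<alpha> t = \<gamma> x t"
      proof (cases "t \<in> carrier T")
        case True
        then obtain y where y: "y \<in> N" "t = \<phi> y"
          using \<phi>_surj by blast
        show ?thesis
          using x y True by (simp add: \<gamma> \<alpha> c_def \<phi>_mult inv)
      next
        case False
        then show ?thesis by (simp add: \<alpha> \<gamma>_def)
      qed
    qed
    then show "\<alpha> \<in> H"
      using x NG by (auto simp: H_def)
  qed
  moreover have "simple_group T" "finite (carrier T)" "\<not> comm_group T"
  proof -
    interpret S: simple_group "G\<lparr>carrier := N\<rparr>" by fact
    show "simple_group T"
      by (rule S.iso_simple[OF T \<phi>])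
    show "finite (carrier T)"
      using bij finN by (metis bij_betw_finite)
    show "\<not> comm_group T"
    proof
      assume "comm_group T"
      then interpret CT: comm_group T .
      have "comm_group (G\<lparr>carrier := N\<rparr>)"
      proof (rule S.group_comm_groupI)
        fix x y assume "x \<in> carrier (G\<lparr>carrier := N\<rparr>)" "y \<in> carrier (G\<lparr>carrier := N\<rparr>)"
        then have xy: "x \<in> N" "y \<in> N" by auto
        then have "\<phi> (x \<otimes>\<^bsub>G\<^esub> y) = \<phi> (y \<otimes>\<^bsub>G\<^esub> x)"
          using \<phi>_mem by (simp add: \<phi>_mult CT.m_comm)
        then have "x \<otimes>\<^bsub>G\<^esub> y = y \<otimes>\<^bsub>G\<^esub> x"
          using bij xy by (auto simp: bij_betw_def inj_on_def)
        then show "x \<otimes>\<^bsub>G\<lparr>carrier := N\<rparr>\<^esub> y = y \<otimes>\<^bsub>G\<lparr>carrier := N\<rparr>\<^esub> x" by simp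
      qed
      with ncomm show False by contradiction
    qed
  qed
  ultimately show ?thesis
    using fin N.is_group unfolding almost_simple_def by blast
qed

lemma almost_simple_iso:
  assumes "almost_simple G" "G \<cong> H" "group H"
  shows "almost_simple H"
proof -
  have G: "group G" "finite (carrier G)"
    using assms(1) by (auto simp: almost_simple_def)
  then have "H \<cong> G"
    using assms(2) by (simp add: group.iso_sym)
  moreover have "finite (carrier H)"
    using assms(2) G(2) by (auto simp: is_iso_def iso_def dest: bij_betw_finite)
  ultimately show ?thesis
    using assms iso_trans unfolding almost_simple_def by blast
qed

lemma almost_simple_perm_monoid:
  assumes \<Omega>: "finite \<Omega>" "card \<Omega> \<ge> 5"
    and G: "perm_closed G" "G \<subseteq> perms_on \<Omega>" and alt: "alt_perms \<Omega> \<subseteq> G"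
  shows "almost_simple (perm_monoid G)"
proof (rule almost_simpleI)
  interpret group "perm_monoid G"
    by (rule group_perm_monoid[OF G(1)])
  show "finite (carrier (perm_monoid G))"
    using finite_perms_on[OF \<Omega>(1)] G(2) finite_subset by auto
  show "simple_group (perm_monoid G\<lparr>carrier := alt_perms \<Omega>\<rparr>)" "\<not> comm_group (perm_monoid G\<lparr>carrier := alt_perms \<Omega>\<rparr>)"
    using simple_alt_perms[OF \<Omega>] by simp_all
  have "subgroup (alt_perms \<Omega>) (perm_monoid G)"
    using alt perm_closedD[OF perm_closed_alt_perms]
    by (intro subgroup.intro) (auto simp: inv_perm_monoid[OF G(1)] subset_iff)
  then show "alt_perms \<Omega> \<lhd> perm_monoid G"
    using alt_perms_conj G inv_perm_monoid[OF G(1)] unfolding normal_inv_iff by auto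
  show "g = \<one>\<^bsub>perm_monoid G\<^esub>" if "g \<in> carrier (perm_monoid G)"
    "\<forall>x\<in>alt_perms \<Omega>. g \<otimes>\<^bsub>perm_monoid G\<^esub> x \<otimes>\<^bsub>perm_monoid G\<^esub> inv\<^bsub>perm_monoid G\<^esub> g = x" for g
    using that G alt_perms_centraliser_trivial[OF \<Omega>, of g] by (auto simp: inv_perm_monoid[OF G(1)])
qed

section \<open>Coset graphs\<close>

lemma group_graph_AutGroup: "group (graph_AutGroup \<Delta>)"
proof -
  let ?V = "pverts \<Delta>"
  let ?H = "{g \<in> Bij ?V. \<forall>u\<in>?V. \<forall>v\<in>?V. (u, v) \<in> parcs \<Delta> \<longleftrightarrow> (g u, g v) \<in> parcs \<Delta>}"
  interpret B: group "BijGroup ?V"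
    by (rule group_BijGroup)
  have "subgroup ?H (BijGroup ?V)"
  proof (rule B.subgroupI)
    show "?H \<subseteq> carrier (BijGroup ?V)"
      by (auto simp: BijGroup_def)
    show "?H \<noteq> {}"
      using id_Bij[of ?V] by force
  next
    fix g assume g: "g \<in> ?H"
    then have img: "g ` ?V = ?V"
      by (auto simp: Bij_def bij_betw_def)
    have "(u, v) \<in> parcs \<Delta> \<longleftrightarrow> (inv_into ?V g u, inv_into ?V g v) \<in> parcs \<Delta>" if "u \<in> ?V" "v \<in> ?V" for u v
      using g that img inv_into_into[of _ g ?V] f_inv_into_f[of _ g ?V] by auto
    then show "inv\<^bsub>BijGroup ?V\<^esub> g \<in> ?H"
      using g by (simp add: inv_BijGroup restrict_inv_into_Bij)
  next
    fix g h assume gh: "g \<in> ?H" "h \<in> ?H"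
    then have "h u \<in> ?V" if "u \<in> ?V" for u
      using that Bij_imp_funcset by fastforce
    then show "g \<otimes>\<^bsub>BijGroup ?V\<^esub> h \<in> ?H"
      using gh compose_Bij[of g ?V h] by (simp add: BijGroup_def) (simp add: compose_def)
  qed
  then show ?thesis
    unfolding graph_AutGroup_def by (rule B.subgroup_imp_group)
qed

text \<open>The group isomorphism is forced to be conjugation by \<beta>. Elements of both groups
  are extensional, so agreement on points suffices for equality, and only the existence of matching
  elements in both directions has to be supplied.\<close>

lemma perm_isomorphicI:
  assumes \<beta>: "bij_betw \<beta> \<Omega> \<Lambda>" and H: "H \<subseteq> Bij \<Omega>" and K: "K \<subseteq> Bij \<Lambda>"
    and HK: "\<And>h. h \<in> H \<Longrightarrow> \<exists>k\<in>K. \<forall>z\<in>\<Omega>. \<beta> (h z) = k (\<beta> z)"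
    and KH: "\<And>k. k \<in> K \<Longrightarrow> \<exists>h\<in>H. \<forall>z\<in>\<Omega>. \<beta> (h z) = k (\<beta> z)"
  shows "perm_isomorphic \<Omega> H \<Lambda> K"
proof -
  define \<psi> where "\<psi> h = (\<lambda>l\<in>\<Lambda>. \<beta> (h (inv_into \<Omega> \<beta> l)))" for h
  have mem: "h z \<in> \<Omega>" if "h \<in> H" "z \<in> \<Omega>" for h z
    using that H Bij_imp_funcset by fastforce
  have \<beta>_mem: "\<beta> z \<in> \<Lambda>" if "z \<in> \<Omega>" for z
    using that \<beta> by (auto simp: bij_betw_def)
  have \<beta>_surj: "\<exists>z\<in>\<Omega>. l = \<beta> z" if "l \<in> \<Lambda>" for l
    using that \<beta> by (auto simp: bij_betw_def)
  have \<psi>: "\<psi> h (\<beta> z) = \<beta> (h z)" if "z \<in> \<Omega>" for h z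
    using that \<beta> by (simp add: \<psi>_def \<beta>_mem bij_betw_inv_into_left)
  have \<psi>_eqI: "\<psi> h = k" if "k \<in> K" "\<And>z. z \<in> \<Omega> \<Longrightarrow> \<beta> (h z) = k (\<beta> z)" for h k
  proof (rule extensionalityI[of _ \<Lambda>])
    show "\<psi> h \<in> extensional \<Lambda>" "k \<in> extensional \<Lambda>"
      using K that(1) by (auto simp: \<psi>_def Bij_def)
    fix l assume "l \<in> \<Lambda>"
    then show "\<psi> h l = k l"
      using \<beta>_surj that(2) \<psi> by metis
  qed
  have \<psi>_mem: "\<psi> h \<in> K" if "h \<in> H" for h
    using HK[OF that] \<psi>_eqI by metis
  have "\<psi> (h \<otimes>\<^bsub>perm_group \<Omega> H\<^esub> h') = \<psi> h \<otimes>\<^bsub>perm_group \<Lambda> K\<^esub> \<psi> h'"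
    if "h \<in> H" "h' \<in> H" for h h'
  proof (rule extensionalityI[of _ \<Lambda>])
    have B: "h \<in> Bij \<Omega>" "h' \<in> Bij \<Omega>" "\<psi> h \<in> Bij \<Lambda>" "\<psi> h' \<in> Bij \<Lambda>"
      using that H K \<psi>_mem by auto
    then show "\<psi> h \<otimes>\<^bsub>perm_group \<Lambda> K\<^esub> \<psi> h' \<in> extensional \<Lambda>" 
      "\<psi> (h \<otimes>\<^bsub>perm_group \<Omega> H\<^esub> h') \<in> extensional \<Lambda>"
      by (auto simp: BijGroup_def \<psi>_def)
    fix l assume "l \<in> \<Lambda>"
    then obtain z where "z \<in> \<Omega>" "l = \<beta> z"
      using \<beta>_surj by blast
    then show "\<psi> (h \<otimes>\<^bsub>perm_group \<Omega> H\<^esub> h') l = (\<psi> h \<otimes>\<^bsub>perm_group \<Lambda> K\<^esub> \<psi> h') l"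
      using B that by (simp add: BijGroup_def compose_def \<psi> \<beta>_mem mem)
  qed
  moreover have "inj_on \<psi> H"
  proof (rule inj_onI)
    fix h h' assume hh: "h \<in> H" "h' \<in> H" "\<psi> h = \<psi> h'"
    show "h = h'"
    proof (rule extensionalityI[of _ \<Omega>])
      show "h \<in> extensional \<Omega>" "h' \<in> extensional \<Omega>"
        using hh H by (auto simp: Bij_def)
      fix z assume z: "z \<in> \<Omega>"
      then have "\<beta> (h z) = \<beta> (h' z)"
        using hh \<psi> by metis
      then show "h z = h' z"
        using \<beta> z hh mem by (auto simp: bij_betw_def inj_on_def)
    qed
  qed
  moreover have "\<psi> ` H = K"
  proof
    show "\<psi> ` H \<subseteq> K"
      using \<psi>_mem by blast
    show "K \<subseteq> \<psi> ` H"
      using KH \<psi>_eqI by (metis image_eqI subsetI)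
  qed
  ultimately have "\<psi> \<in> iso (perm_group \<Omega> H) (perm_group \<Lambda> K)"
    using \<psi>_mem by (auto simp: iso_def hom_def bij_betw_def)
  then show ?thesis
    unfolding perm_isomorphic_def using \<beta> \<psi> by metis
qed

section \<open>Coset graphs and their automorphisms\<close>

lemma ex_coset_labelling:
  fixes A :: "'a perm set"
  assumes "perm_closed A" "finite G"
  shows "\<exists>\<phi> :: 'a perm \<Rightarrow> nat. \<forall>g\<in>G. \<forall>h\<in>G. \<phi> g = \<phi> h \<longleftrightarrow> inverse g * h \<in> A"
proof -
  define c where "c g = (*) g ` A" for g :: "'a perm"
  \<comment> \<open>The vertices are to be natural numbers, so the finitely many cosets are
    numbered.\<close>
  obtain e :: "'a perm set \<Rightarrow> nat" where e: "inj_on e (c ` G)"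
    using finite_imp_inj_to_nat_seg[of "c ` G"] assms(2) by auto
  have "c g = c h \<longleftrightarrow> inverse g * h \<in> A" for g h
  proof
    assume "c g = c h"
    then have "h \<in> c g"
      using perm_closedD(1)[OF assms(1)] by (force simp: c_def)
    then show "inverse g * h \<in> A"
      by (auto simp: c_def)
  next
    assume *: "inverse g * h \<in> A"
    have sub: "c y \<subseteq> c x" if "inverse x * y \<in> A" for x y
    proof
      fix z assume "z \<in> c y"
      then obtain a where a: "a \<in> A" "z = y * a"
        by (auto simp: c_def)
      then have "z = x * (inverse x * y * a)"
        by (simp add: mult.assoc)
      then show "z \<in> c x"
        using a that perm_closedD(2)[OF assms(1)] by (auto simp: c_def)
    qed
    have "inverse h * g \<in> A"
      using perm_closedD(3)[OF assms(1) *] by simp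
    with * sub show "c g = c h"
      by blast
  qed
  moreover have "e (c g) = e (c h) \<longleftrightarrow> c g = c h" if "g \<in> G" "h \<in> G" for g h
    using e that by (auto dest: inj_onD)
  ultimately show ?thesis
    by (intro exI[of _ "\<lambda>g. e (c g)"]) simp
qed

text \<open>The assumptions match properties of the graph: \<open>t \<notin> A\<close> rules out
  loops, \<open>t * t = 1\<close> makes adjacency symmetric, \<open>span\<close> gives
  connectedness, and \<open>core\<close>, the triviality of the intersection of all conjugates of
  \<open>A\<close>, makes the action on cosets faithful.\<close>

locale coset_graph =
  fixes G A :: "'a perm set" and t :: "'a perm" and \<phi> :: "'a perm \<Rightarrow> nat"
  assumes G: "perm_closed G" and finite_G: "finite G"
    and A: "perm_closed A" and A_subset: "A \<subseteq> G"
    and t: "t \<in> G" "t \<notin> A" and t_mult_t: "t * t = 1"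
    and span: "perm_span (insert t A) = G"
    and core: "\<And>g. g \<in> G \<Longrightarrow> (\<And>h. h \<in> G \<Longrightarrow> inverse h * g * h \<in> A) \<Longrightarrow> g = 1"
    and \<phi>_eq_iff: "\<And>g h. g \<in> G \<Longrightarrow> h \<in> G \<Longrightarrow> \<phi> g = \<phi> h \<longleftrightarrow> inverse g * h \<in> A"
begin

text \<open>The number \<open>\<phi> g\<close> names the left coset \<open>gA\<close>.\<close>

definition graph :: "nat pair_pre_digraph" where
  "graph = \<lparr>pverts = \<phi> ` G, parcs = {(\<phi> g, \<phi> (g * t)) | g. g \<in> G}\<rparr>"

text \<open>Left multiplication on cosets, computed on a chosen representative;
  \<open>act_\<phi>\<close> shows independence of the choice. The restriction to the vertices suits
  \<open>BijGroup\<close>.\<close>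

definition act :: "'a perm \<Rightarrow> nat \<Rightarrow> nat" where
  "act g = (\<lambda>v\<in>\<phi> ` G. \<phi> (g * inv_into G \<phi> v))"

lemma pverts_graph [simp]: "pverts graph = \<phi> ` G"
  by (simp add: graph_def)

lemmas G_closed [simp] = perm_closedD[OF G]
lemmas A_closed [simp] = perm_closedD[OF A]

lemma A_in_G [simp]: "a \<in> A \<Longrightarrow> a \<in> G"
  using A_subset by blast

lemma t_in_G [simp]: "t \<in> G"
  by (rule t)

lemma inverse_t [simp]: "inverse t = t"
  by (rule perm.inverse_unique) (rule t_mult_t)

lemma t_t_cancel [simp]: "t * (t * g) = g"
  by (simp flip: mult.assoc add: t_mult_t)

lemma \<phi>_left_cancel: "k \<in> G \<Longrightarrow> g \<in> G \<Longrightarrow> h \<in> G \<Longrightarrow> \<phi> (k * g) = \<phi> (k * h) \<longleftrightarrow> \<phi> g = \<phi> h"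
  by (simp add: \<phi>_eq_iff mult.assoc)

lemma \<phi>_mult_A: "g \<in> G \<Longrightarrow> a \<in> A \<Longrightarrow> \<phi> (g * a) = \<phi> g"
  using \<phi>_eq_iff[of g "g * a"] by simp

lemma act_\<phi>:
  assumes "g \<in> G" "h \<in> G"
  shows "act g (\<phi> h) = \<phi> (g * h)"
proof -
  have "inv_into G \<phi> (\<phi> h) \<in> G" "\<phi> (inv_into G \<phi> (\<phi> h)) = \<phi> h"
    using assms by (auto intro: inv_into_into f_inv_into_f)
  then show ?thesis
    using assms by (simp add: act_def \<phi>_left_cancel)
qed

lemma act_ext: "act g \<in> extensional (\<phi> ` G)"
  by (simp add: act_def)

lemma act_eqI:
  assumes "\<And>h. h \<in> G \<Longrightarrow> f (\<phi> h) = \<phi> (g * h)" "f \<in> extensional (\<phi> ` G)" "g \<in> G"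
  shows "act g = f"
  by (rule extensionalityI[OF act_ext]) (use assms act_\<phi> in auto)

lemma act_Bij: "g \<in> G \<Longrightarrow> act g \<in> Bij (\<phi> ` G)"
  unfolding Bij_def
  by (auto simp: act_ext act_\<phi> intro!: bij_betw_byWitness[where f' = "act (inverse g)"])

lemma act_mult:
  assumes "g \<in> G" "h \<in> G"
  shows "act (g * h) = act g \<otimes>\<^bsub>BijGroup (\<phi> ` G)\<^esub> act h"
proof (rule act_eqI)
  show "act g \<otimes>\<^bsub>BijGroup (\<phi> ` G)\<^esub> act h \<in> extensional (\<phi> ` G)"
    using assms by (simp add: BijGroup_def act_Bij)
qed (use assms in \<open>simp_all add: BijGroup_def act_Bij compose_def act_\<phi> mult.assoc\<close>)

text \<open>If \<open>g\<close> and \<open>h\<close> act alike, then \<open>inverse h * g\<close>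
  lies in every conjugate of \<open>A\<close>.\<close>

lemma inj_on_act: "inj_on act G"
proof (rule inj_onI)
  fix g h assume gh: "g \<in> G" "h \<in> G" "act g = act h"
  have "inverse h * g = 1"
  proof (rule core)
    fix k assume k: "k \<in> G"
    have "\<phi> (g * k) = \<phi> (h * k)"
      using act_\<phi> gh k by metis
    then have "\<phi> (h * k) = \<phi> (g * k)" by simp
    then show "inverse k * (inverse h * g) * k \<in> A"
      using gh k by (simp add: \<phi>_eq_iff mult.assoc)
  qed (use gh in simp)
  then show "g = h"
    by (metis inverse_mult_cancel(2) mult.right_neutral)
qed

text \<open>The definition of \<open>graph\<close> uses one representative for both ends of an arc.
  An arbitrary representative of the first coset differs from it by an element \<open>a\<close> of
  \<open>A\<close>, so adjacency is governed by the double coset of \<open>t\<close>.\<close>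

lemma mem_parcs_iff:
  assumes "g \<in> G" "h \<in> G"
  shows "(\<phi> g, \<phi> h) \<in> parcs graph \<longleftrightarrow> (\<exists>a\<in>A. \<phi> h = \<phi> (g * a * t))"
proof
  assume "(\<phi> g, \<phi> h) \<in> parcs graph"
  then obtain k where k: "k \<in> G" "\<phi> g = \<phi> k" "\<phi> h = \<phi> (k * t)"
    by (auto simp: graph_def)
  then have "inverse g * k \<in> A"
    using assms by (simp add: \<phi>_eq_iff)
  moreover have "\<phi> h = \<phi> (g * (inverse g * k) * t)"
    using k by simp
  ultimately show "\<exists>a\<in>A. \<phi> h = \<phi> (g * a * t)"
    by blast
next
  assume "\<exists>a\<in>A. \<phi> h = \<phi> (g * a * t)"
  then obtain a where "a \<in> A" "\<phi> h = \<phi> (g * a * t)"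
    by blast
  then show "(\<phi> g, \<phi> h) \<in> parcs graph"
    using assms \<phi>_mult_A[of g a] by (auto simp: graph_def intro!: exI[of _ "g * a"])
qed

lemma neighbours_graph: "g \<in> G \<Longrightarrow> neighbours graph (\<phi> g) = {\<phi> (g * a * t) | a. a \<in> A}"
proof -
  assume g: "g \<in> G"
  have "v \<in> \<phi> ` G" if "(u, v) \<in> parcs graph" for u v
    using that by (auto simp: graph_def)
  then show ?thesis
    using g mem_parcs_iff[OF g] unfolding neighbours_def by fastforce
qed

lemma arcE:
  assumes "(x, y) \<in> parcs graph"
  obtains g where "g \<in> G" "x = \<phi> g" "y = \<phi> (g * t)"
  using assms by (auto simp: graph_def)

lemma pair_graph: "pair_graph graph"
proof
  show "fst e \<in> pverts graph" "snd e \<in> pverts graph" if "e \<in> parcs graph" for e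
    using that by (auto simp: graph_def)
  show "finite (pverts graph)"
    by (simp add: finite_G)
  have "parcs graph = (\<lambda>g. (\<phi> g, \<phi> (g * t))) ` G"
    by (auto simp: graph_def)
  then show "finite (parcs graph)"
    by (simp add: finite_G)
  show "fst e \<noteq> snd e" if "e \<in> parcs graph" for e
    using that t(2) \<phi>_eq_iff by (auto elim!: arcE simp: graph_def)
  have "(\<phi> (g * t), \<phi> g) \<in> parcs graph" if "g \<in> G" for g
    using that by (auto simp: graph_def t_mult_t mult.assoc intro!: exI[of _ "g * t"])
  then show "symmetric (with_proj graph)"
    unfolding symmetric_def sym_def by (auto simp: graph_def)
qed

text \<open>Right multiplication by an element of \<open>A\<close> keeps the vertex, and right
  multiplication by \<open>t\<close> follows an arc. So the \<open>g\<close> for which every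
  \<open>\<phi> h\<close> is joined to \<open>\<phi> (h * g)\<close> by a path form a subgroup
  containing all generators.\<close>

lemma connected: "connected (with_proj graph)"
proof -
  let ?R = "rtrancl_on (\<phi> ` G) ((parcs graph)\<^sup>s)"
  define H where "H = {g \<in> G. \<forall>h\<in>G. (\<phi> h, \<phi> (h * g)) \<in> ?R}"
  have refl: "(\<phi> h, \<phi> h) \<in> ?R" if "h \<in> G" for h
    using that by simp
  have sym: "(v, u) \<in> ?R" if "(u, v) \<in> ?R" for u v
  proof -
    have "((parcs graph)\<^sup>s)\<inverse> = (parcs graph)\<^sup>s"
      by (auto simp: symcl_def)
    then show ?thesis
      using rtrancl_on_converseI[OF that] by simp
  qed
  have "perm_closed H"
    unfolding perm_closed_def
  proof (intro conjI ballI)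
    show "1 \<in> H"
      using refl by (simp add: H_def)
    show "g * g' \<in> H" if "g \<in> H" "g' \<in> H" for g g'
    proof -
      have "(\<phi> h, \<phi> (h * (g * g'))) \<in> ?R" if "h \<in> G" for h
      proof (rule rtrancl_on_trans)
        show "(\<phi> h, \<phi> (h * g)) \<in> ?R"
          using \<open>g \<in> H\<close> that by (simp add: H_def)
        have "h * g \<in> G"
          using \<open>g \<in> H\<close> that by (simp add: H_def)
        then show "(\<phi> (h * g), \<phi> (h * (g * g'))) \<in> ?R"
          using \<open>g' \<in> H\<close> by (simp add: H_def flip: mult.assoc)
      qed
      then show ?thesis
        using that by (simp add: H_def)
    qed
    show "inverse g \<in> H" if "g \<in> H" for g
    proof -
      have "(\<phi> h, \<phi> (h * inverse g)) \<in> ?R" if "h \<in> G" for h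
      proof -
        have "h * inverse g \<in> G"
          using \<open>g \<in> H\<close> that by (simp add: H_def)
        then have "(\<phi> (h * inverse g), \<phi> (h * inverse g * g)) \<in> ?R"
          using \<open>g \<in> H\<close> unfolding H_def by blast
        then show ?thesis
          using sym by (simp add: mult.assoc)
      qed
      then show ?thesis
        using that by (simp add: H_def)
    qed
  qed
  moreover have "A \<subseteq> H"
    by (auto simp: H_def \<phi>_mult_A)
  moreover have "t \<in> H"
  proof -
    have "(\<phi> h, \<phi> (h * t)) \<in> ?R" if "h \<in> G" for h
    proof (rule rtrancl_on_into_rtrancl_on[OF refl[OF that]])
      show "(\<phi> h, \<phi> (h * t)) \<in> (parcs graph)\<^sup>s"
        using that by (auto simp: symcl_def graph_def)
    qed (use that in simp)
    then show ?thesis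
      by (simp add: H_def)
  qed
  ultimately have "G \<subseteq> H"
    using perm_span_least[of H "insert t A"] span by simp
  have "(\<phi> g, \<phi> h) \<in> ?R" if "g \<in> G" "h \<in> G" for g h
  proof -
    have "inverse g * h \<in> H"
      using that \<open>G \<subseteq> H\<close> by auto
    then have "(\<phi> g, \<phi> (g * (inverse g * h))) \<in> ?R"
      using that unfolding H_def by blast
    then show ?thesis by simp
  qed
  moreover have "\<phi> ` G \<noteq> {}"
    using t by blast
  ultimately show ?thesis
    unfolding connected_conv by auto
qed

lemma subgroup_act_image: "subgroup (act ` G) (graph_AutGroup graph)"
proof -
  have arc: "(u, v) \<in> parcs graph \<longleftrightarrow> (act g u, act g v) \<in> parcs graph"
    if g: "g \<in> G" and uv: "u \<in> \<phi> ` G" "v \<in> \<phi> ` G" for g u v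
  proof -
    obtain h k where hk: "h \<in> G" "k \<in> G" "u = \<phi> h" "v = \<phi> k"
      using uv by blast
    have "(\<phi> k = \<phi> (h * a * t)) = (\<phi> (g * k) = \<phi> (g * h * a * t))" if "a \<in> A" for a
      using \<phi>_left_cancel[of g k "h * a * t"] hk that g by (simp add: mult.assoc)
    then show ?thesis
      using hk g by (simp add: act_\<phi> mem_parcs_iff)
  qed
  interpret group_hom "perm_monoid G" "graph_AutGroup graph" act
  proof (intro group_hom.intro group_hom_axioms.intro homI)
    show "group (perm_monoid G)" "group (graph_AutGroup graph)"
      by (rule group_perm_monoid[OF G], rule group_graph_AutGroup)
    show "act g \<in> carrier (graph_AutGroup graph)" if "g \<in> carrier (perm_monoid G)" for g
      using that arc by (simp add: graph_AutGroup_def act_Bij)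
    show "act (g \<otimes>\<^bsub>perm_monoid G\<^esub> h) = act g \<otimes>\<^bsub>graph_AutGroup graph\<^esub> act h"
      if "g \<in> carrier (perm_monoid G)" "h \<in> carrier (perm_monoid G)" for g h
      using that by (simp add: graph_AutGroup_def act_mult)
  qed
  show ?thesis
    using img_is_subgroup by simp
qed

lemma act_iso: "perm_monoid G \<cong> perm_group (pverts graph) (act ` G)"
proof -
  have "act \<in> iso (perm_monoid G) (perm_group (pverts graph) (act ` G))"
    by (auto simp: iso_def hom_def act_mult inj_on_act bij_betw_def)
  then show ?thesis
    by (auto simp: is_iso_def)
qed

lemma subgroup_BijGroup_act_image: "subgroup (act ` G) (BijGroup (pverts graph))"
proof -
  interpret group_hom "perm_monoid G" "BijGroup (pverts graph)" act
    by (intro group_hom.intro group_hom_axioms.intro homI)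
      (auto simp: group_perm_monoid[OF G] group_BijGroup act_mult, simp add: BijGroup_def act_Bij)
  show ?thesis
    using img_is_subgroup by simp
qed

text \<open>Arcs have the form \<open>(\<phi> g, \<phi> (g * t))\<close>, and left multiplication by
  \<open>h * inverse g\<close> moves the arc of \<open>g\<close> to that of
  \<open>h\<close>.\<close>

lemma arc_transitive: "arc_transitive graph (act ` G)"
proof -
  let ?P = "perm_group (pverts graph) (act ` G)"
  define \<alpha> where "\<alpha> g = (\<lambda>(u, v)\<in>parcs graph. (g u, g v))" for g :: "nat \<Rightarrow> nat"
  have \<alpha>: "\<alpha> (act g) (\<phi> h, \<phi> (h * t)) = (\<phi> (g * h), \<phi> (g * h * t))" if "g \<in> G" "h \<in> G" for g h
  proof -
    have "(\<phi> h, \<phi> (h * t)) \<in> parcs graph"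
      using that by (auto simp: graph_def)
    then show ?thesis
      using that by (simp add: \<alpha>_def act_\<phi> mult.assoc)
  qed
  have \<alpha>_parcs: "\<alpha> (act g) e \<in> parcs graph" if "g \<in> G" "e \<in> parcs graph" for g e
    using that by (cases e) (auto elim!: arcE simp: \<alpha>, auto simp: graph_def)
  have \<alpha>_inv: "\<alpha> (act h) (\<alpha> (act g) e) = e" if "g \<in> G" "h \<in> G" "h * g = 1" "e \<in> parcs graph" for g h e
    using that by (cases e) (auto elim!: arcE simp: \<alpha> simp flip: mult.assoc)
  have \<alpha>_Bij: "\<alpha> (act g) \<in> Bij (parcs graph)" if "g \<in> G" for g
  proof -
    have "bij_betw (\<alpha> (act g)) (parcs graph) (parcs graph)"
      using that by (intro bij_betw_byWitness[where f' = "\<alpha> (act (inverse g))"])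
        (auto simp: \<alpha>_inv \<alpha>_parcs)
    then show ?thesis
      by (simp add: Bij_def \<alpha>_def)
  qed
  have "transitive_action ?P (parcs graph) \<alpha>"
  proof (intro transitive_action.intro group_action.intro group_hom.intro group_hom_axioms.intro
      homI transitive_action_axioms.intro)
    show "group ?P"
      by (rule subgroup.subgroup_is_group[OF subgroup_BijGroup_act_image group_BijGroup])
    show "group (BijGroup (parcs graph))"
      by (rule group_BijGroup)
    show "\<alpha> f \<in> carrier (BijGroup (parcs graph))" if "f \<in> carrier ?P" for f
      using that \<alpha>_Bij by (auto simp: BijGroup_def)
    show "\<alpha> (f \<otimes>\<^bsub>?P\<^esub> f') = \<alpha> f \<otimes>\<^bsub>BijGroup (parcs graph)\<^esub> \<alpha> f'" 
      if "f \<in> carrier ?P" "f' \<in> carrier ?P" for f f'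
    proof -
      obtain g g' where g: "g \<in> G" "g' \<in> G" "f = act g" "f' = act g'"
        using \<open>f \<in> carrier ?P\<close> \<open>f' \<in> carrier ?P\<close> by auto
      have "\<alpha> (act (g * g')) = \<alpha> (act g) \<otimes>\<^bsub>BijGroup (parcs graph)\<^esub> \<alpha> (act g')"
      proof (rule extensionalityI[of _ "parcs graph"])
        show "\<alpha> (act (g * g')) \<in> extensional (parcs graph)"
          by (simp add: \<alpha>_def)
        show "\<alpha> (act g) \<otimes>\<^bsub>BijGroup (parcs graph)\<^esub> \<alpha> (act g') \<in> extensional (parcs graph)"
          using g by (simp add: BijGroup_def \<alpha>_Bij)
        fix e assume e: "e \<in> parcs graph"
        then obtain h where "h \<in> G" "e = (\<phi> h, \<phi> (h * t))"
          by (cases e) (auto elim!: arcE)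
        then show "\<alpha> (act (g * g')) e = (\<alpha> (act g) \<otimes>\<^bsub>BijGroup (parcs graph)\<^esub> \<alpha> (act g')) e"
          using g e \<alpha>[of g "g' * h"] by (simp add: BijGroup_def \<alpha>_Bij compose_def \<alpha> mult.assoc)
      qed
      then show ?thesis
        using g by (simp add: act_mult)
    qed
    show "\<exists>f\<in>carrier ?P. \<alpha> f x = y" if xy: "x \<in> parcs graph" "y \<in> parcs graph" for x y
    proof -
      obtain g h where gh: "g \<in> G" "h \<in> G" "x = (\<phi> g, \<phi> (g * t))" "y = (\<phi> h, \<phi> (h * t))"
        using xy by (auto simp: graph_def)
      then have "\<alpha> (act (h * inverse g)) x = y"
        by (simp add: \<alpha> mult.assoc)
      then show ?thesis
        using gh by auto
    qed
  qed
  then show ?thesis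
    by (simp add: arc_transitive_def \<alpha>_def[abs_def])
qed

section \<open>Vertex stabilisers and the local action\<close>

lemma vertex_stabiliser_graph:
  assumes "g \<in> G"
  shows "vertex_stabiliser graph (act ` G) (\<phi> g) = (\<lambda>a. act (g * a * inverse g)) ` A"
proof (intro subset_antisym subsetI)
  fix f assume "f \<in> vertex_stabiliser graph (act ` G) (\<phi> g)"
  then obtain h where h: "h \<in> G" "f = act h" "\<phi> g = \<phi> (h * g)"
    using assms by (auto simp: stabilizer_def act_\<phi>)
  then have "inverse g * (h * g) \<in> A"
    using assms by (simp add: \<phi>_eq_iff)
  moreover have "g * (inverse g * (h * g)) * inverse g = h"
    by (simp add: mult.assoc)
  ultimately show "f \<in> (\<lambda>a. act (g * a * inverse g)) ` A"
    unfolding h(2) by (intro image_eqI[of _ _ "inverse g * (h * g)"]) simp_all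
next
  fix f assume "f \<in> (\<lambda>a. act (g * a * inverse g)) ` A"
  then show "f \<in> vertex_stabiliser graph (act ` G) (\<phi> g)"
    using assms by (auto simp: stabilizer_def act_\<phi> \<phi>_mult_A mult.assoc)
qed

end

text \<open>\<open>\<Lambda>\<close> is an abstract model of the neighbours of a vertex. Those of
  the coset \<open>A\<close> are the cosets \<open>a * t * A\<close>, permuted transitively by
  \<open>A\<close>, and the stabiliser of \<open>t * A\<close> is the intersection of
  \<open>A\<close> with its conjugate by \<open>t\<close>. The same is required of
  \<open>\<omega>\<close> in \<open>\<Lambda>\<close>.\<close>

locale coset_graph_local_action = coset_graph +
  fixes \<Lambda> :: "'b set" and \<omega> :: 'b and \<rho> :: "'a perm \<Rightarrow> 'b \<Rightarrow> 'b"
  assumes \<rho>_Bij: "\<And>a. a \<in> A \<Longrightarrow> \<rho> a \<in> Bij \<Lambda>"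
    and \<rho>_mult: "\<And>a b l. a \<in> A \<Longrightarrow> b \<in> A \<Longrightarrow> l \<in> \<Lambda> \<Longrightarrow> \<rho> (a * b) l = \<rho> a (\<rho> b l)"
    and \<omega>: "\<omega> \<in> \<Lambda>"
    and \<rho>_transitive: "\<And>l. l \<in> \<Lambda> \<Longrightarrow> \<exists>a\<in>A. \<rho> a \<omega> = l"
    and \<rho>_stabiliser: "\<And>a. a \<in> A \<Longrightarrow> \<rho> a \<omega> = \<omega> \<longleftrightarrow> t * a * t \<in> A"
begin

lemma \<rho>_mem: "a \<in> A \<Longrightarrow> l \<in> \<Lambda> \<Longrightarrow> \<rho> a l \<in> \<Lambda>"
  using \<rho>_Bij Bij_imp_funcset by fastforce

lemma \<rho>_inverse: "a \<in> A \<Longrightarrow> l \<in> \<Lambda> \<Longrightarrow> \<rho> a l = l' \<longleftrightarrow> l' \<in> \<Lambda> \<and> l = \<rho> (inverse a) l'"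
proof -
  \<comment> \<open>The unit acts trivially because \<open>\<rho> 1\<close> is idempotent and
    injective.\<close>
  have one: "\<rho> 1 l = l" if "l \<in> \<Lambda>" for l
  proof -
    have "\<rho> 1 (\<rho> 1 l) = \<rho> 1 l"
      using \<rho>_mult[of 1 1 l] that by simp
    moreover have "inj_on (\<rho> 1) \<Lambda>"
      using \<rho>_Bij[of 1] by (simp add: Bij_def bij_betw_def)
    ultimately show ?thesis
      using that \<rho>_mem[of 1] by (simp add: inj_on_eq_iff)
  qed
  assume a: "a \<in> A" "l \<in> \<Lambda>"
  then show ?thesis
    using \<rho>_mem[of a l] \<rho>_mult[of "inverse a" a l] \<rho>_mult[of a "inverse a" l'] one by auto
qed

text \<open>Both sides say that \<open>inverse a * b\<close> stabilises \<omega>: the equality of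
  cosets means that its conjugate by \<open>t\<close> lies in \<open>A\<close>, which is the
  condition in \<open>\<rho>_stabiliser\<close>.\<close>

lemma \<phi>_neighbour_eq_iff:
  assumes "g \<in> G" "a \<in> A" "b \<in> A"
  shows "\<phi> (g * a * t) = \<phi> (g * b * t) \<longleftrightarrow> \<rho> a \<omega> = \<rho> b \<omega>"
proof -
  have "\<phi> (g * a * t) = \<phi> (g * b * t) \<longleftrightarrow> t * (inverse a * b) * t \<in> A"
    using assms by (simp add: \<phi>_eq_iff mult.assoc)
  also have "\<dots> \<longleftrightarrow> \<rho> (inverse a) (\<rho> b \<omega>) = \<omega>"
    using assms \<rho>_stabiliser[of "inverse a * b"] by (simp add: \<rho>_mult \<omega>)
  also have "\<dots> \<longleftrightarrow> \<rho> a \<omega> = \<rho> b \<omega>"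
    using assms \<rho>_inverse[of a \<omega> "\<rho> b \<omega>"] by (auto simp: \<omega> \<rho>_mem)
  finally show ?thesis .
qed

text \<open>The identification of the neighbours of \<open>\<phi> g\<close> with
  \<open>\<Lambda>\<close>. By \<open>\<phi>_neighbour_eq_iff\<close> the choice of \<open>a\<close>
  does not affect the value.\<close>

definition local_coord :: "'a perm \<Rightarrow> nat \<Rightarrow> 'b" where
  "local_coord g v = \<rho> (SOME a. a \<in> A \<and> v = \<phi> (g * a * t)) \<omega>"

lemma local_coord:
  assumes "g \<in> G" "a \<in> A"
  shows "local_coord g (\<phi> (g * a * t)) = \<rho> a \<omega>"
proof -
  let ?b = "SOME b. b \<in> A \<and> \<phi> (g * a * t) = \<phi> (g * b * t)"
  have "?b \<in> A \<and> \<phi> (g * a * t) = \<phi> (g * ?b * t)"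
    by (rule someI[of _ a]) (simp add: assms)
  then have "\<rho> a \<omega> = \<rho> ?b \<omega>"
    using \<phi>_neighbour_eq_iff[OF assms, of ?b] by blast
  then show ?thesis
    by (simp add: local_coord_def)
qed

lemma bij_betw_local_coord:
  assumes g: "g \<in> G"
  shows "bij_betw (local_coord g) (neighbours graph (\<phi> g)) \<Lambda>"
  unfolding bij_betw_def
proof
  show "inj_on (local_coord g) (neighbours graph (\<phi> g))"
    using g by (auto simp: inj_on_def neighbours_graph local_coord \<phi>_neighbour_eq_iff)
  have "local_coord g ` neighbours graph (\<phi> g) = (\<lambda>a. \<rho> a \<omega>) ` A"
    unfolding neighbours_graph[OF g] by (force simp: local_coord[OF g])
  also have "\<dots> = \<Lambda>"
    using \<rho>_transitive \<rho>_mem \<omega> by blast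
  finally show "local_coord g ` neighbours graph (\<phi> g) = \<Lambda>" .
qed

lemma card_neighbours: "g \<in> G \<Longrightarrow> card (neighbours graph (\<phi> g)) = card \<Lambda>"
  by (rule bij_betw_same_card[OF bij_betw_local_coord])

lemma act_conj_neighbour:
  assumes "g \<in> G" "a \<in> A" "b \<in> A"
  shows "act (g * a * inverse g) (\<phi> (g * b * t)) = \<phi> (g * (a * b) * t)"
  using assms by (simp add: act_\<phi> mult.assoc)

text \<open>The stabiliser of \<open>\<phi> g\<close> consists of the conjugates
  \<open>g * a * inverse g\<close>, which send \<open>\<phi> (g * b * t)\<close> to
  \<open>\<phi> (g * (a * b) * t)\<close>. In local coordinates this is
  \<open>\<rho> a\<close>.\<close>

lemma local_group_perm_isomorphic:
  assumes g: "g \<in> G"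
  shows "perm_isomorphic (neighbours graph (\<phi> g)) (local_group graph (act ` G) (\<phi> g)) \<Lambda> (\<rho> ` A)"
proof (rule perm_isomorphicI)
  let ?N = "neighbours graph (\<phi> g)"
  let ?r = "\<lambda>a. restrict (act (g * a * inverse g)) ?N"
  show "bij_betw (local_coord g) ?N \<Lambda>"
    by (rule bij_betw_local_coord[OF g])
  show "\<rho> ` A \<subseteq> Bij \<Lambda>"
    using \<rho>_Bij by blast
  have lg: "local_group graph (act ` G) (\<phi> g) = ?r ` A"
    unfolding local_group_def vertex_stabiliser_graph[OF g] by (simp add: image_image)
  have r: "?r a (\<phi> (g * b * t)) = \<phi> (g * (a * b) * t)" if "a \<in> A" "b \<in> A" for a b
    using that g act_conj_neighbour[OF g that] by (auto simp: neighbours_graph)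
  show "local_group graph (act ` G) (\<phi> g) \<subseteq> Bij ?N"
  proof
    fix f assume "f \<in> local_group graph (act ` G) (\<phi> g)"
    then obtain a where a: "a \<in> A" "f = ?r a"
      unfolding lg by blast
    have N: "\<exists>b\<in>A. v = \<phi> (g * b * t)" if "v \<in> ?N" for v
      using that g by (auto simp: neighbours_graph)
    have N': "\<phi> (g * b * t) \<in> ?N" if "b \<in> A" for b
      using that g by (auto simp: neighbours_graph)
    have "bij_betw f ?N ?N"
    proof (rule bij_betw_byWitness[where f' = "?r (inverse a)"])
      show "\<forall>v\<in>?N. ?r (inverse a) (f v) = v"
        unfolding a(2) using N r a(1) by (metis A_closed(2,3) inverse_mult_cancel(1))
      show "\<forall>v\<in>?N. f (?r (inverse a) v) = v"
        unfolding a(2) using N r a(1) by (metis A_closed(2,3) inverse_mult_cancel(2))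
      show "f ` ?N \<subseteq> ?N" "?r (inverse a) ` ?N \<subseteq> ?N"
        unfolding a(2) image_subset_iff using N N' r a(1) by (metis A_closed(2,3))+
    qed
    then show "f \<in> Bij ?N"
      by (simp add: Bij_def a(2))
  qed
  have coord: "local_coord g (?r a v) = \<rho> a (local_coord g v)" if av: "a \<in> A" "v \<in> ?N" for a v
  proof -
    obtain b where b: "b \<in> A" "v = \<phi> (g * b * t)"
      using av(2) g by (auto simp: neighbours_graph)
    then show ?thesis
      unfolding b(2) r[OF av(1) b(1)]
      using av(1) local_coord[OF g] by (simp add: \<rho>_mult \<omega>)
  qed
  show "\<exists>k\<in>\<rho> ` A. \<forall>z\<in>?N. local_coord g (h z) = k (local_coord g z)"
    if "h \<in> local_group graph (act ` G) (\<phi> g)" for h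
    using that coord unfolding lg by blast
  show "\<exists>h\<in>local_group graph (act ` G) (\<phi> g). \<forall>z\<in>?N. local_coord g (h z) = k (local_coord g z)"
    if "k \<in> \<rho> ` A" for k
    using that coord unfolding lg by blast
qed

section \<open>Local kernels and arc kernels\<close>

lemma local_kernel_graph:
  assumes g: "g \<in> G"
  shows "local_kernel graph (act ` G) (\<phi> g) =
    (\<lambda>a. act (g * a * inverse g)) ` {a \<in> A. \<forall>l\<in>\<Lambda>. \<rho> a l = l}"
proof -
  have "(\<forall>v\<in>neighbours graph (\<phi> g). act (g * a * inverse g) v = v) \<longleftrightarrow> (\<forall>l\<in>\<Lambda>. \<rho> a l = l)"
    if a: "a \<in> A" for a
  proof -
    have "(\<forall>v\<in>neighbours graph (\<phi> g). act (g * a * inverse g) v = v) \<longleftrightarrow>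
        (\<forall>b\<in>A. \<phi> (g * (a * b) * t) = \<phi> (g * b * t))"
      unfolding neighbours_graph[OF g] using act_conj_neighbour[OF g a] by auto
    also have "\<dots> \<longleftrightarrow> (\<forall>b\<in>A. \<rho> a (\<rho> b \<omega>) = \<rho> b \<omega>)"
      using a g \<rho>_mult \<omega> by (simp add: \<phi>_neighbour_eq_iff)
    also have "\<dots> \<longleftrightarrow> (\<forall>l\<in>\<Lambda>. \<rho> a l = l)"
      using \<rho>_transitive \<rho>_mem[OF _ \<omega>] by metis
    finally show ?thesis .
  qed
  then show ?thesis
    unfolding local_kernel_def vertex_stabiliser_graph[OF g] by auto
qed

text \<open>The kernel of the arc \<open>(\<phi> 1, \<phi> t)\<close>, pulled back to
  \<open>A\<close>; those of the other arcs arise from it by conjugation.\<close>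

definition arc_kernel_base :: "'a perm set" where
  "arc_kernel_base =
     {c \<in> A. (\<forall>l\<in>\<Lambda>. \<rho> c l = l) \<and> t * c * t \<in> A \<and> (\<forall>l\<in>\<Lambda>. \<rho> (t * c * t) l = l)}"

lemma arc_kernel_graph:
  assumes g: "g \<in> G"
  shows "arc_kernel graph (act ` G) (\<phi> g) (\<phi> (g * t)) = (\<lambda>c. act (g * c * inverse g)) ` arc_kernel_base"
proof (intro subset_antisym subsetI)
  fix f assume "f \<in> arc_kernel graph (act ` G) (\<phi> g) (\<phi> (g * t))"
  then obtain c d where c: "c \<in> A" "\<forall>l\<in>\<Lambda>. \<rho> c l = l" "f = act (g * c * inverse g)"
    and d: "d \<in> A" "\<forall>l\<in>\<Lambda>. \<rho> d l = l" "f = act (g * t * d * inverse (g * t))"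
    using g local_kernel_graph[of g] local_kernel_graph[of "g * t"] by (auto simp: arc_kernel_def)
  \<comment> \<open>Membership in the two local kernels describes \<open>f\<close> through
    \<open>c\<close> at one end and \<open>d\<close> at the other; faithfulness identifies the two
    and gives \<open>d = t * c * t\<close>.\<close>
  have "g * c * inverse g = g * t * d * inverse (g * t)"
    by (rule inj_onD[OF inj_on_act]) (use c d g in \<open>simp_all flip: mult.assoc\<close>)
  then have "inverse g * (g * c * inverse g) * g = inverse g * (g * t * d * inverse (g * t)) * g"
    by simp
  then have "c = t * d * t"
    by (simp add: mult.assoc)
  then have "t * c * t = d"
    by (simp add: mult.assoc t_mult_t)
  then have "c \<in> arc_kernel_base"
    using c d by (simp add: arc_kernel_base_def)
  then show "f \<in> (\<lambda>c. act (g * c * inverse g)) ` arc_kernel_base"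
    using c(3) by blast
next
  fix f assume "f \<in> (\<lambda>c. act (g * c * inverse g)) ` arc_kernel_base"
  then obtain c where c: "c \<in> A" "\<forall>l\<in>\<Lambda>. \<rho> c l = l" "t * c * t \<in> A" "\<forall>l\<in>\<Lambda>. \<rho> (t * c * t) l = l"
    "f = act (g * c * inverse g)"
    by (auto simp: arc_kernel_base_def)
  then have "f \<in> local_kernel graph (act ` G) (\<phi> g)"
    unfolding local_kernel_graph[OF g] by blast
  moreover have "g * c * inverse g = g * t * (t * c * t) * inverse (g * t)"
    by (simp add: mult.assoc)
  with c have "f \<in> local_kernel graph (act ` G) (\<phi> (g * t))"
    unfolding local_kernel_graph[OF G_closed(2)[OF g t_in_G]]
    by (intro image_eqI[of _ _ "t * c * t"]) simp_all
  ultimately show "f \<in> arc_kernel graph (act ` G) (\<phi> g) (\<phi> (g * t))"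
    by (simp add: arc_kernel_def)
qed

lemma arc_kernel_iso:
  assumes g: "g \<in> G"
  shows "perm_monoid arc_kernel_base \<cong>
    perm_group (pverts graph) (arc_kernel graph (act ` G) (\<phi> g) (\<phi> (g * t)))"
proof -
  let ?f = "\<lambda>c. act (g * c * inverse g)"
  have K: "c \<in> G" if "c \<in> arc_kernel_base" for c
    using that by (simp add: arc_kernel_base_def)
  have "inj_on ?f arc_kernel_base"
  proof (rule inj_onI)
    fix c d assume cd: "c \<in> arc_kernel_base" "d \<in> arc_kernel_base" "?f c = ?f d"
    then have "g * c * inverse g = g * d * inverse g"
      using inj_onD[OF inj_on_act cd(3)] g K by simp
    then have "inverse g * (g * c * inverse g) * g = inverse g * (g * d * inverse g) * g"
      by simp
    then show "c = d"
      by (simp add: mult.assoc)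
  qed
  moreover have "?f (c * d) = ?f c \<otimes>\<^bsub>BijGroup (\<phi> ` G)\<^esub> ?f d" 
    if "c \<in> arc_kernel_base" "d \<in> arc_kernel_base" for c d
    using that g K act_mult[of "g * c * inverse g" "g * d * inverse g"] by (simp add: mult.assoc)
  ultimately have "?f \<in> iso (perm_monoid arc_kernel_base)
      (perm_group (pverts graph) (arc_kernel graph (act ` G) (\<phi> g) (\<phi> (g * t))))"
    unfolding arc_kernel_graph[OF g] iso_def hom_def bij_betw_def pverts_graph by simp
  then show ?thesis
    by (auto simp: is_iso_def)
qed

end

section \<open>The construction\<close>

lemma transitive_perm_groupD:
  assumes "transitive_perm_group \<Omega> H"
  shows "h \<in> H \<Longrightarrow> h \<in> Bij \<Omega>"
    and "h \<in> H \<Longrightarrow> h' \<in> H \<Longrightarrow> compose \<Omega> h h' \<in> H"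
    and "(\<lambda>x\<in>\<Omega>. x) \<in> H"
    and "x \<in> \<Omega> \<Longrightarrow> y \<in> \<Omega> \<Longrightarrow> \<exists>h\<in>H. h x = y"
proof -
  interpret subgroup H "BijGroup \<Omega>"
    using assms by (simp add: transitive_perm_group_def)
  have Bij: "H \<subseteq> Bij \<Omega>"
    using subset by (simp add: BijGroup_def)
  then show "h \<in> Bij \<Omega>" if "h \<in> H" for h
    using that by blast
  then show "h \<in> H \<Longrightarrow> h' \<in> H \<Longrightarrow> compose \<Omega> h h' \<in> H"
    using m_closed[of h h'] by (simp add: BijGroup_def)
  show "(\<lambda>x\<in>\<Omega>. x) \<in> H"
    using one_closed by (simp add: BijGroup_def)
  interpret transitive_action "perm_group \<Omega> H" \<Omega> "\<lambda>h. h"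
    using assms by (simp add: transitive_perm_group_def)
  show "x \<in> \<Omega> \<Longrightarrow> y \<in> \<Omega> \<Longrightarrow> \<exists>h\<in>H. h x = y"
    using unique_orbit[of x y] by simp
qed

section \<open>Coordinates, the group \<open>A\<close> and the involution \<open>t\<close>\<close>

locale wreath_construction =
  fixes r s m :: nat and R S :: "(nat \<Rightarrow> nat) set"
  assumes r: "r > 1" and s: "s > 1"
    and R: "transitive_perm_group {..<r} R" and S: "transitive_perm_group {..<s} S"
    and m: "m \<ge> 3" "odd m"
begin

text \<open>
  \<open>coord j i\<close> says that \<open>(j, i)\<close> is one of the \<open>s m + 1\<close> coordinates: \<open>(0, 0)\<close> is fixed by \<open>S\<close>, and
  the others form \<open>m\<close> copies of the natural \<open>S\<close>-set. A point \<open>(k, j, i, z)\<close> is an element \<open>z\<close> in the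
  \<open>k\<close>-th copy of the block of the coordinate \<open>(j, i)\<close>.
\<close>

definition coord :: "nat \<Rightarrow> nat \<Rightarrow> bool" where
  "coord j i \<longleftrightarrow> j = 0 \<and> i = 0 \<or> 1 \<le> j \<and> j \<le> m \<and> i < s"

definition points :: "(nat \<times> nat \<times> nat \<times> nat) set" where
  "points = {(k, j, i, z). k < 2 \<and> coord j i \<and> z < r} - {(1, 0, 0, 0)}"

definition shift :: "(nat \<Rightarrow> nat) \<Rightarrow> nat \<Rightarrow> nat \<Rightarrow> nat" where
  "shift \<sigma> j i = (if j = 0 then 0 else \<sigma> i)"

text \<open>The component \<open>f j i\<close> acts inside the block of \<open>(j, i)\<close>, and
  \<sigma> moves the block. Both copies \<open>k\<close> carry the same action.\<close>

definition alpha :: "(nat \<Rightarrow> nat \<Rightarrow> nat \<Rightarrow> nat) \<Rightarrow> (nat \<Rightarrow> nat) \<Rightarrow> (nat \<times> nat \<times> nat \<times> nat) perm" where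
  "alpha f \<sigma> = Perm (\<lambda>(k, j, i, z). if (k, j, i, z) \<in> points
     then (k, j, shift \<sigma> j i, f j i z) else (k, j, i, z))"

text \<open>The equation \<open>f 0 0 0 = 0\<close> puts the component at the fixed coordinate into
  a point stabiliser of \<open>R\<close>. Thus \<open>alpha\<close> fixes
  \<open>(0, 0, 0, 0)\<close> and preserves the second copy without its deleted point. Membership in
  \<open>R\<close> is demanded for all pairs to avoid side conditions.\<close>

definition valid :: "(nat \<Rightarrow> nat \<Rightarrow> nat \<Rightarrow> nat) \<Rightarrow> (nat \<Rightarrow> nat) \<Rightarrow> bool" where
  "valid f \<sigma> \<longleftrightarrow> (\<forall>j i. f j i \<in> R) \<and> f 0 0 0 = 0 \<and> \<sigma> \<in> S"

definition A :: "(nat \<times> nat \<times> nat \<times> nat) perm set" where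
  "A = {alpha f \<sigma> | f \<sigma>. valid f \<sigma>}"

text \<open>The pairs are 0-1, 2-3, ..., (m-1)-m for \<open>i = 0\<close>, and 1-2, ..., (m-2)-(m-1)
  with \<open>m\<close> fixed for other \<open>i\<close>. Only whether \<open>i = 0\<close> matters,
  so permutations of the columns that fix 0 are respected. In the places with \<open>j = m\<close>
  and \<open>i \<noteq> 0\<close>, which \<open>tau\<close> fixes, \<open>t\<close> switches the
  copy, and this links the two copies.\<close>

definition tau :: "nat \<Rightarrow> nat \<Rightarrow> nat" where
  "tau j i = (if i = 0 then if even j then j + 1 else j - 1
     else if j = m then m else if odd j then j + 1 else j - 1)"

text \<open>
  Fixing \<open>(1, 1, 0, 0)\<close>, whose image would be the missing point \<open>(1, 0, 0, 0)\<close>, is what produces a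
  three-cycle.
\<close>

definition t :: "(nat \<times> nat \<times> nat \<times> nat) perm" where
  "t = Perm (\<lambda>(k, j, i, z). if (k, j, i, z) \<in> points - {(1, 1, 0, 0)}
     then (if j = m \<and> i \<noteq> 0 then 1 - k else k, tau j i, i, z) else (k, j, i, z))"

definition G :: "(nat \<times> nat \<times> nat \<times> nat) perm set" where
  "G = perm_span (insert t A)"

abbreviation id_r :: "nat \<Rightarrow> nat" where
  "id_r \<equiv> \<lambda>x\<in>{..<r}. x"

abbreviation id_s :: "nat \<Rightarrow> nat" where
  "id_s \<equiv> \<lambda>x\<in>{..<s}. x"

lemma finite_points: "finite points"
proof -
  have "points \<subseteq> {..<2} \<times> {..m} \<times> {..<s} \<times> {..<r}"
    using s by (auto simp: points_def coord_def)
  then show ?thesis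
    by (rule finite_subset) simp
qed

lemma R_less: "\<rho> \<in> R \<Longrightarrow> z < r \<Longrightarrow> \<rho> z < r"
  using transitive_perm_groupD(1)[OF R] Bij_imp_funcset by fastforce

lemma S_less: "\<sigma> \<in> S \<Longrightarrow> i < s \<Longrightarrow> \<sigma> i < s"
  using transitive_perm_groupD(1)[OF S] Bij_imp_funcset by fastforce

lemma R_eq_iff: "\<rho> \<in> R \<Longrightarrow> z < r \<Longrightarrow> z' < r \<Longrightarrow> \<rho> z = \<rho> z' \<longleftrightarrow> z = z'"
  using transitive_perm_groupD(1)[OF R] by (auto simp: Bij_def bij_betw_def dest: inj_onD)

lemma S_eq_iff: "\<sigma> \<in> S \<Longrightarrow> i < s \<Longrightarrow> i' < s \<Longrightarrow> \<sigma> i = \<sigma> i' \<longleftrightarrow> i = i'"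
  using transitive_perm_groupD(1)[OF S] by (auto simp: Bij_def bij_betw_def dest: inj_onD)

lemmas R_compose = transitive_perm_groupD(2)[OF R]
lemmas S_compose = transitive_perm_groupD(2)[OF S]
lemmas R_id = transitive_perm_groupD(3)[OF R]
lemmas S_id = transitive_perm_groupD(3)[OF S]

lemma R_transitive: "z < r \<Longrightarrow> z' < r \<Longrightarrow> \<exists>\<rho>\<in>R. \<rho> z = z'"
  using transitive_perm_groupD(4)[OF R] by simp

lemma S_transitive: "i < s \<Longrightarrow> i' < s \<Longrightarrow> \<exists>\<sigma>\<in>S. \<sigma> i = i'"
  using transitive_perm_groupD(4)[OF S] by simp

lemma points_iff: "(k, j, i, z) \<in> points \<longleftrightarrow> k < 2 \<and> coord j i \<and> z < r \<and> \<not> (k = 1 \<and> j = 0 \<and> z = 0)"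
  by (auto simp: points_def coord_def)

lemma coord_shift: "coord j i \<Longrightarrow> \<sigma> \<in> S \<Longrightarrow> coord j (shift \<sigma> j i)"
  by (auto simp: coord_def shift_def S_less)

lemma alpha:
  assumes v: "valid f \<sigma>"
  shows apply_alpha: "alpha f \<sigma> \<langle>$\<rangle> (k, j, i, z) =
      (if (k, j, i, z) \<in> points then (k, j, shift \<sigma> j i, f j i z) else (k, j, i, z))"
    and alpha_perms_on: "alpha f \<sigma> \<in> perms_on points"
proof -
  let ?a = "\<lambda>(k, j, i, z). if (k, j, i, z) \<in> points then (k, j, shift \<sigma> j i, f j i z) else (k, j, i, z)"
  have f: "f j i \<in> R" "f 0 0 0 = 0" and \<sigma>: "\<sigma> \<in> S" for j i
    using v by (auto simp: valid_def)
  \<comment> \<open>Since \<open>f 0 0\<close> is injective and fixes 0, no point of the second copy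
    is sent to the deleted one.\<close>
  have zero: "f 0 0 z = 0 \<longleftrightarrow> z = 0" if "z < r" for z
    using R_eq_iff[of "f 0 0" z 0] that f r by simp
  have mem: "?a ` points \<subseteq> points"
    using f(1) \<sigma> zero by (auto simp: points_iff R_less coord_shift split: if_splits)
      (auto simp: coord_def)
  have inj: "inj_on ?a points"
    using f(1) \<sigma> by (auto simp: inj_on_def points_iff coord_def shift_def R_eq_iff S_eq_iff split: if_splits)
  have "apply (alpha f \<sigma>) = ?a" "alpha f \<sigma> \<in> perms_on points"
    unfolding alpha_def using apply_Perm_of_inj_on[OF finite_points mem inj] by auto
  then show "alpha f \<sigma> \<langle>$\<rangle> (k, j, i, z) =
      (if (k, j, i, z) \<in> points then (k, j, shift \<sigma> j i, f j i z) else (k, j, i, z))"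
    "alpha f \<sigma> \<in> perms_on points"
    by simp_all
qed

lemma alpha_cong:
  assumes "\<And>j i z. coord j i \<Longrightarrow> z < r \<Longrightarrow> f j i z = f' j i z" "\<And>i. i < s \<Longrightarrow> \<sigma> i = \<sigma>' i"
  shows "alpha f \<sigma> = alpha f' \<sigma>'"
  unfolding alpha_def
  by (rule arg_cong[of _ _ Perm]) (use assms in \<open>auto simp: fun_eq_iff points_iff shift_def coord_def\<close>)

text \<open>This is the multiplication of the wreath product: the component of the left factor is
  read at the coordinate to which the right factor has moved the block.\<close>

lemma alpha_mult:
  assumes v: "valid f \<sigma>" "valid f' \<sigma>'"
  defines "f'' \<equiv> \<lambda>j i. compose {..<r} (f j (shift \<sigma>' j i)) (f' j i)"
  shows "valid f'' (compose {..<s} \<sigma> \<sigma>')"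
    and "alpha f \<sigma> * alpha f' \<sigma>' = alpha f'' (compose {..<s} \<sigma> \<sigma>')"
proof -
  show v'': "valid f'' (compose {..<s} \<sigma> \<sigma>')"
    using v R_compose S_compose r by (simp add: valid_def f''_def compose_def shift_def)
  show "alpha f \<sigma> * alpha f' \<sigma>' = alpha f'' (compose {..<s} \<sigma> \<sigma>')"
  proof (rule perm_eqI)
    fix p :: "nat \<times> nat \<times> nat \<times> nat"
    obtain k j i z where p: "p = (k, j, i, z)"
      by (cases p)
    show "(alpha f \<sigma> * alpha f' \<sigma>') \<langle>$\<rangle> p = alpha f'' (compose {..<s} \<sigma> \<sigma>') \<langle>$\<rangle> p"
    proof (cases "p \<in> points")
      case True
      have "f'' j i z = f j (shift \<sigma>' j i) (f' j i z)"
        using True p by (simp add: f''_def compose_def points_iff)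
      moreover have "shift (compose {..<s} \<sigma> \<sigma>') j i = shift \<sigma> j (shift \<sigma>' j i)"
        using True p by (auto simp: shift_def points_iff coord_def compose_def)
      moreover have "(k, j, shift \<sigma>' j i, f' j i z) \<in> points"
        using True perms_on_apply_iff[OF alpha_perms_on[OF v(2)], of p] apply_alpha[OF v(2), of k j i z] p by simp
      ultimately show ?thesis
        using True p
        by (simp add: apply_times apply_alpha[OF v(1)] apply_alpha[OF v(2)] apply_alpha[OF v''])
    next
      case False
      then show ?thesis
        using perms_onD[OF alpha_perms_on[OF v(1)], of p] perms_onD[OF alpha_perms_on[OF v(2)], of p]
          perms_onD[OF alpha_perms_on[OF v''], of p] by (simp add: apply_times)
    qed
  qed
qed

lemma A_subset_perms_on: "A \<subseteq> perms_on points"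
  using alpha_perms_on by (auto simp: A_def)

lemma alpha_mem_A: "valid f \<sigma> \<Longrightarrow> alpha f \<sigma> \<in> A"
  by (auto simp: A_def)

lemma A_cases:
  assumes "a \<in> A"
  obtains f \<sigma> where "valid f \<sigma>" "a = alpha f \<sigma>"
  using assms by (auto simp: A_def)

lemma perm_closed_A: "perm_closed A"
proof (rule perm_closed_of_finite)
  show "finite A"
    using A_subset_perms_on finite_perms_on[OF finite_points] by (rule finite_subset)
  have "valid (\<lambda>j i. id_r) id_s"
    using R_id S_id r by (simp add: valid_def)
  then show "A \<noteq> {}"
    using alpha_mem_A by blast
  show "a * b \<in> A" if "a \<in> A" "b \<in> A" for a b
  proof -
    obtain f \<sigma> f' \<sigma>' where v: "valid f \<sigma>" "valid f' \<sigma>'" and ab: "a = alpha f \<sigma>" "b = alpha f' \<sigma>'"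
      using \<open>a \<in> A\<close> \<open>b \<in> A\<close> by (elim A_cases)
    show ?thesis
      unfolding ab alpha_mult(2)[OF v] by (rule alpha_mem_A[OF alpha_mult(1)[OF v]])
  qed
qed

text \<open>The oddness of \<open>m\<close> enters: an even \<open>j\<close> is below
  \<open>m\<close>, and so is an odd \<open>j\<close> other than \<open>m\<close>, hence steps
  upwards stay in range.\<close>

lemma coord_tau: "coord j i \<Longrightarrow> coord (tau j i) i"
  using m s by (auto simp: coord_def tau_def elim!: oddE evenE)

lemma tau_tau: "coord j i \<Longrightarrow> tau (tau j i) i = j"
  using m by (auto simp: coord_def tau_def)

lemma tau_eq_0_iff: "coord j i \<Longrightarrow> tau j i = 0 \<longleftrightarrow> j = 1 \<and> i = 0"
  using m by (auto simp: coord_def tau_def)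

lemma tau_eq_m_iff: "coord j i \<Longrightarrow> i \<noteq> 0 \<Longrightarrow> tau j i = m \<longleftrightarrow> j = m"
  using tau_tau[of j i] by (auto simp: tau_def split: if_splits)

lemma tau_eq_1_iff: "coord j 0 \<Longrightarrow> tau j 0 = 1 \<longleftrightarrow> j = 0"
  by (auto simp: tau_def elim!: oddE)

lemma t:
  shows apply_t: "t \<langle>$\<rangle> (k, j, i, z) = (if (k, j, i, z) \<in> points - {(1, 1, 0, 0)}
     then (if j = m \<and> i \<noteq> 0 then 1 - k else k, tau j i, i, z) else (k, j, i, z))"
    and t_perms_on: "t \<in> perms_on points"
    and t_mult_t: "t * t = 1"
proof -
  define T where "T = (\<lambda>(k, j, i, z). if (k, j, i, z) \<in> points - {(1, 1, 0, 0)}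
     then (if j = m \<and> i \<noteq> 0 then 1 - k else k, tau j i, i, z) else (k, j, i, z))"
  have T: "T (k, j, i, z) = (if (k, j, i, z) \<in> points - {(1, 1, 0, 0)}
     then (if j = m \<and> i \<noteq> 0 then 1 - k else k, tau j i, i, z) else (k, j, i, z))" for k j i z
    by (simp only: T_def prod.case)
  have mem: "T p \<in> points - {(1, 1, 0, 0)}" "T (T p) = p" if "p \<in> points - {(1, 1, 0, 0)}" for p
  proof -
    obtain k j i z where p: "p = (k, j, i, z)"
      by (cases p)
    have c: "coord j i" "k < 2" "z < r"
      using that p by (auto simp: points_iff)
    have Tp: "T p = (if j = m \<and> i \<noteq> 0 then 1 - k else k, tau j i, i, z)"
      using that p by (simp add: T)
    \<comment> \<open>Row 0 is reached only from \<open>j = 1\<close>, \<open>i = 0\<close>, and the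
      exclusion of \<open>(1, 1, 0, 0)\<close> keeps the image off the deleted point. Conversely
      \<open>(1, 1, 0, 0)\<close> could only be reached from the deleted point.\<close>
    have q: "(if j = m \<and> i \<noteq> 0 then 1 - k else k, tau j i, i, z) \<in> points - {(1, 1, 0, 0)}"
      using that p c m coord_tau[OF c(1)] tau_eq_0_iff[OF c(1)] tau_eq_1_iff[of j]
      by (cases "i = 0") (auto simp: points_iff)
    show "T p \<in> points - {(1, 1, 0, 0)}"
      using q by (simp only: Tp)
    show "T (T p) = p"
      unfolding Tp T if_P[OF q] using c tau_eq_m_iff[OF c(1)] tau_tau[OF c(1)] p by auto
  qed
  have fixed: "T p = p" if "p \<notin> points - {(1, 1, 0, 0)}" for p
  proof -
    obtain k j i z where "p = (k, j, i, z)"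
      by (cases p)
    with that show ?thesis
      by (simp only: T if_False)
  qed
  have invol: "T (T p) = p" for p
  proof (cases "p \<in> points - {(1, 1, 0, 0)}")
    case True
    then show ?thesis
      by (rule mem(2))
  next
    case False
    then have "T p = p"
      by (rule fixed)
    then show ?thesis
      by simp
  qed
  have "inj_on T points"
    by (rule inj_on_inverseI[of _ T]) (rule invol)
  moreover have "T ` points \<subseteq> points"
  proof
    fix q assume "q \<in> T ` points"
    then obtain p where p: "p \<in> points" "q = T p" by blast
    show "q \<in> points"
    proof (cases "p = (1, 1, 0, 0)")
      case True
      then have "T p = p"
        by (intro fixed) blast
      with p show ?thesis by simp
    next
      case False
      then show ?thesis
        using mem(1)[of p] p by blast
    qed
  qed
  moreover have "T p = p" if "p \<notin> points" for p
    using that by (intro fixed) blast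
  ultimately have apply_T: "apply t = T" and on: "t \<in> perms_on points"
    unfolding t_def T_def[symmetric] using apply_Perm_of_inj_on[OF finite_points, of T] by blast+
  show "t \<langle>$\<rangle> (k, j, i, z) = (if (k, j, i, z) \<in> points - {(1, 1, 0, 0)}
     then (if j = m \<and> i \<noteq> 0 then 1 - k else k, tau j i, i, z) else (k, j, i, z))"
    unfolding apply_T by (rule T)
  show "t \<in> perms_on points"
    by (rule on)
  show "t * t = 1"
    by (rule perm_eqI) (simp only: apply_times apply_T comp_apply invol apply_one id_apply)
qed

lemma t_t [simp]: "t \<langle>$\<rangle> (t \<langle>$\<rangle> p) = p"
  by (simp add: apply_sequence t_mult_t)

text \<open>The assumptions describe the stabiliser of \<open>(0, 1, 0, 0)\<close> in
  \<open>A\<close>. As \<sigma> fixes 0, it commutes with \<open>tau\<close>, and conjugation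
  permutes the components along \<open>tau\<close>. The component arriving at \<open>(0, 0)\<close>
  is \<open>f 1 0\<close>, which has to fix 0.\<close>

lemma t_conj_alpha:
  assumes v: "valid f \<sigma>" and fx: "\<sigma> 0 = 0" "f 1 0 0 = 0"
  shows "valid (\<lambda>j i. f (tau j i) i) \<sigma>" and "t * alpha f \<sigma> * t = alpha (\<lambda>j i. f (tau j i) i) \<sigma>"
proof -
  show v': "valid (\<lambda>j i. f (tau j i) i) \<sigma>"
    using v fx by (simp add: valid_def tau_def)
  have f0: "f 0 0 0 = 0" and \<sigma>: "\<sigma> \<in> S"
    using v by (auto simp: valid_def)
  have tau10: "tau 1 0 = 0"
    by (simp add: tau_def)
  have "alpha f \<sigma> * t = t * alpha (\<lambda>j i. f (tau j i) i) \<sigma>"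
  proof (rule perm_eqI)
    fix p :: "nat \<times> nat \<times> nat \<times> nat"
    obtain k j i z where p: "p = (k, j, i, z)"
      by (cases p)
    show "(alpha f \<sigma> * t) \<langle>$\<rangle> p = (t * alpha (\<lambda>j i. f (tau j i) i) \<sigma>) \<langle>$\<rangle> p"
    proof (cases "p \<in> points")
      case False
      then show ?thesis
        using perms_onD[OF t_perms_on, of p] perms_onD[OF alpha_perms_on[OF v], of p]
          perms_onD[OF alpha_perms_on[OF v'], of p] by (simp add: apply_times)
    next
      case pt: True
      then have c: "coord j i" "k < 2" "z < r"
        using p by (auto simp: points_iff)
      have sh: "shift \<sigma> j i = shift \<sigma> (tau j i) i" "shift \<sigma> j i = 0 \<longleftrightarrow> i = 0"
        using c \<sigma> fx S_eq_iff[OF \<sigma>, of i 0] s by (auto simp: shift_def coord_def tau_def)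
      have tau_sh: "tau j (shift \<sigma> j i) = tau j i"
        using sh by (auto simp: tau_def)
      show ?thesis
      proof (cases "p = (1, 1, 0, 0)")
        case True
        then show ?thesis
          using pt f0 fx tau10
          by (simp add: apply_times apply_t apply_alpha[OF v] apply_alpha[OF v'] shift_def)
      next
        case False
        have tp: "t \<langle>$\<rangle> p \<in> points"
          using perms_on_apply_iff[OF t_perms_on] pt by blast
        have ap: "alpha (\<lambda>j i. f (tau j i) i) \<sigma> \<langle>$\<rangle> p \<in> points"
          using perms_on_apply_iff[OF alpha_perms_on[OF v']] pt by blast
        \<comment> \<open>The conjugated element has the component \<open>f 0 0\<close> at
          \<open>(1, 0)\<close>, so it fixes \<open>(1, 1, 0, 0)\<close> and sends no other point
          there.\<close>
        have "alpha (\<lambda>j i. f (tau j i) i) \<sigma> \<langle>$\<rangle> p \<noteq> (1, 1, 0, 0)"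
        proof
          assume "alpha (\<lambda>j i. f (tau j i) i) \<sigma> \<langle>$\<rangle> p = (1, 1, 0, 0)"
          also have "\<dots> = alpha (\<lambda>j i. f (tau j i) i) \<sigma> \<langle>$\<rangle> (1, 1, 0, 0)"
            using s r m f0 fx tau10 by (simp add: apply_alpha[OF v'] points_iff coord_def shift_def)
          finally show False
            using False by (simp add: apply_inj)
        qed
        then show ?thesis
          using tp ap pt p False sh tau_sh
          by (simp add: apply_times apply_t apply_alpha[OF v] apply_alpha[OF v'])
      qed
    qed
  qed
  then have "t * alpha f \<sigma> * t = t * t * alpha (\<lambda>j i. f (tau j i) i) \<sigma>"
    by (simp only: mult.assoc)
  then show "t * alpha f \<sigma> * t = alpha (\<lambda>j i. f (tau j i) i) \<sigma>"
    by (simp only: t_mult_t mult_1_left)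
qed

lemma perm_closed_G: "perm_closed G"
  unfolding G_def by (rule perm_closed_perm_span)

lemma G_subset_perms_on: "G \<subseteq> perms_on points"
  unfolding G_def using A_subset_perms_on t_perms_on
  by (intro perm_span_least[OF perm_closed_perms_on]) auto

lemma A_subset_G: "A \<subseteq> G" and t_in_G: "t \<in> G"
  using perm_span_superset[of "insert t A"] by (auto simp: G_def)

section \<open>Transitivity and faithfulness of the generated group\<close>

lemma A_transitive:
  assumes "k < 2" "1 \<le> j" "j \<le> m" "i < s" "i' < s" "z < r" "z' < r"
  obtains a where "a \<in> A" "a \<langle>$\<rangle> (k, j, i, z) = (k, j, i', z')"
proof -
  obtain \<sigma> \<rho> where \<sigma>: "\<sigma> \<in> S" "\<sigma> i = i'" and \<rho>: "\<rho> \<in> R" "\<rho> z = z'"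
    using S_transitive R_transitive assms by meson
  \<comment> \<open>At the fixed coordinate the component must stabilise 0, hence the identity
    there.\<close>
  define f where "f = (\<lambda>j i :: nat. if j = (0 :: nat) then id_r else \<rho>)"
  have v: "valid f \<sigma>"
    using \<sigma> \<rho> R_id r by (simp add: valid_def f_def)
  have "(k, j, i, z) \<in> points"
    using assms by (simp add: points_iff coord_def)
  then have "alpha f \<sigma> \<langle>$\<rangle> (k, j, i, z) = (k, j, i', z')"
    unfolding apply_alpha[OF v] using assms \<sigma> \<rho> by (simp add: f_def shift_def)
  then show ?thesis
    using that alpha_mem_A[OF v] by blast
qed

text \<open>
  Starting in the copy \<open>k = 1\<close> with \<open>j = 1\<close>, the involution moves upwards through \<open>j = 2, \<dots>, m\<close>,
  changes to the copy \<open>k = 0\<close> at \<open>j = m\<close>, and then moves downwards.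
\<close>

lemma points_subset_invariant:
  assumes start: "(1, 1, 0, 0) \<in> C"
    and A: "\<And>a p. a \<in> A \<Longrightarrow> p \<in> C \<Longrightarrow> a \<langle>$\<rangle> p \<in> C"
    and t: "\<And>p. p \<in> C \<Longrightarrow> t \<langle>$\<rangle> p \<in> C"
  shows "points \<subseteq> C"
proof -
  define row where "row k j \<longleftrightarrow> (\<forall>i<s. \<forall>z<r. (k, j, i, z) \<in> C)" for k j :: nat
  have rowI: "row k j" if *: "(k, j, i, z) \<in> C" "k < 2" "1 \<le> j" "j \<le> m" "i < s" "z < r" for k j i z
    unfolding row_def
  proof (intro allI impI)
    fix i' z' assume "i' < s" "z' < r"
    then obtain a where "a \<in> A" "a \<langle>$\<rangle> (k, j, i, z) = (k, j, i', z')"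
      using A_transitive[of k j i i' z z'] * by blast
    then show "(k, j, i', z') \<in> C"
      using A *(1) by metis
  qed
  have tC: "(if j = m \<and> i \<noteq> 0 then 1 - k else k, tau j i, i, z) \<in> C"
    if "row k j" "k < 2" "1 \<le> j" "j \<le> m" "i < s" "z < r" "(k, j, i, z) \<noteq> (1, 1, 0, 0)" for k j i z
  proof -
    have "(k, j, i, z) \<in> points" "(k, j, i, z) \<in> C"
      using that by (auto simp: points_iff coord_def row_def)
    then show ?thesis
      using t[of "(k, j, i, z)"] that(7) by (simp add: apply_t)
  qed
  \<comment> \<open>Columns 0 and 1 suffice. The excluded places are \<open>j = 1\<close>,
    \<open>i = 0\<close>, which leads to row 0, and \<open>j = m\<close>, \<open>i = 1\<close>,
    where \<open>t\<close> changes the copy.\<close>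
  have row_tau: "row k (tau j i)" if "row k j" "k < 2" "2 \<le> j \<or> i = 1" "1 \<le> j" "j \<le> m" "i \<le> 1" "\<not> (j = m \<and> i = 1)" for k j i
  proof (rule rowI)
    show "(k, tau j i, i, 0) \<in> C"
      using tC[of k j i 0] that s r by (auto split: if_splits)
    have c: "coord j i"
      using that s by (auto simp: coord_def)
    then show "1 \<le> tau j i" "tau j i \<le> m" "i < s"
      using coord_tau[OF c] tau_eq_0_iff[OF c] that s by (auto simp: coord_def)
  qed (use that r in auto)
  have up: "row 1 j" if "1 \<le> j" "j \<le> m" for j
    using that
  proof (induction j rule: dec_induct)
    case base
    show ?case
      using rowI[OF start] s r m by auto
  next
    case (step j)
    \<comment> \<open>Odd rows go up in column 1 and even rows in column 0; on the way down the
      columns alternate likewise.\<close>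
    have "tau j (if odd j then 1 else 0) = Suc j"
      using step by (simp add: tau_def)
    then show ?case
      using row_tau[of 1 j "if odd j then 1 else 0"] step by (cases "j = 1") (auto split: if_splits)
  qed
  have down: "row 0 j" if "1 \<le> j" "j \<le> m" for j
    using that(2,1)
  proof (induction j rule: inc_induct)
    case base
    \<comment> \<open>At \<open>j = m\<close> and \<open>i = 1\<close> the row is kept and the copy
      switches from 1 to 0; this column exists because \<open>s > 1\<close>.\<close>
    have "(0, m, 1, 0) \<in> C"
      using tC[of 1 m 1 0] up[of m] m s r by (simp add: tau_def)
    then show ?case
      using rowI[of 0 m 1 0] m s r by simp
  next
    case (step j)
    have "tau (Suc j) (if odd j then 1 else 0) = j"
      using step m by (auto simp: tau_def)
    moreover have "odd j \<Longrightarrow> Suc j \<noteq> m"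
      using m by auto
    ultimately show ?case
      using row_tau[of 0 "Suc j" "if odd j then 1 else 0"] step by (auto split: if_splits)
  qed
  show ?thesis
  proof
    fix p assume p: "p \<in> points"
    obtain k j i z where kjiz: "p = (k, j, i, z)"
      by (cases p)
    with p have c: "coord j i" "k < 2" "z < r" "\<not> (k = 1 \<and> j = 0 \<and> z = 0)"
      by (auto simp: points_iff)
    have rows: "row k j" if "1 \<le> j" "j \<le> m" "k < 2" for j
      using up[OF that(1,2)] down[OF that(1,2)] that(3) by (cases "k = 0") (auto simp: less_2_cases_iff)
    show "p \<in> C"
    proof (cases "j = 0")
      case True
      then have "i = 0"
        using c by (simp add: coord_def)
      \<comment> \<open>Row 0 comes from row 1. For \<open>k = 1\<close> the deleted point forces
        \<open>z \<noteq> 0\<close>, so the point fixed by \<open>t\<close> is avoided.\<close>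
      have "(k, tau 1 0, 0, z) \<in> C"
        using tC[of k 1 0 z] rows[of 1] c m s True by auto
      then show ?thesis
        using True \<open>i = 0\<close> kjiz by (simp add: tau_def)
    next
      case False
      then show ?thesis
        using rows[of j] c kjiz by (auto simp: row_def coord_def)
    qed
  qed
qed

lemma G_transitive:
  assumes "p \<in> points" "q \<in> points"
  obtains g where "g \<in> G" "g \<langle>$\<rangle> p = q"
proof -
  let ?C = "{g \<langle>$\<rangle> (1, 1, 0, 0) | g. g \<in> G}"
  have "points \<subseteq> ?C"
  proof (rule points_subset_invariant)
    have "1 \<langle>$\<rangle> (1, 1, 0, 0) = (1, 1, 0, 0 :: nat)"
      by simp
    then show "(1, 1, 0, 0) \<in> ?C"
      using perm_closedD(1)[OF perm_closed_G] by (metis (mono_tags, lifting) mem_Collect_eq)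
    have *: "g \<langle>$\<rangle> x \<in> ?C" if g: "g \<in> G" and x: "x \<in> ?C" for g x
    proof -
      obtain h where "h \<in> G" "x = h \<langle>$\<rangle> (1, 1, 0, 0)"
        using x by blast
      then show ?thesis
        using perm_closedD(2)[OF perm_closed_G g] by (auto simp: apply_sequence)
    qed
    show "a \<langle>$\<rangle> x \<in> ?C" if "a \<in> A" "x \<in> ?C" for a x
      by (rule *) (use that A_subset_G in auto)
    show "t \<langle>$\<rangle> x \<in> ?C" if "x \<in> ?C" for x
      by (rule *[OF t_in_G that])
  qed
  then obtain g h where gh: "g \<in> G" "h \<in> G" "p = g \<langle>$\<rangle> (1, 1, 0, 0)" "q = h \<langle>$\<rangle> (1, 1, 0, 0)"
    using assms by blast
  then have "(h * inverse g) \<langle>$\<rangle> p = q"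
    by (simp add: apply_times)
  then show ?thesis
    using that gh perm_closedD[OF perm_closed_G] by blast
qed

text \<open>Every element of \<open>A\<close> fixes \<open>(0, 0, 0, 0)\<close>. By transitivity, an
  element lying in all conjugates of \<open>A\<close> fixes every point.\<close>

lemma G_core:
  assumes g: "g \<in> G" and core: "\<And>h. h \<in> G \<Longrightarrow> inverse h * g * h \<in> A"
  shows "g = 1"
proof (rule perm_eqI)
  fix p
  show "g \<langle>$\<rangle> p = 1 \<langle>$\<rangle> p"
  proof (cases "p \<in> points")
    case True
    have inf: "(0, 0, 0, 0) \<in> points"
      using r by (simp add: points_iff coord_def)
    obtain h where h: "h \<in> G" "h \<langle>$\<rangle> (0, 0, 0, 0) = p"
      using G_transitive[OF inf True] .
    obtain f \<sigma> where f: "valid f \<sigma>" "inverse h * g * h = alpha f \<sigma>"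
      using core[OF h(1)] by (rule A_cases)
    have "alpha f \<sigma> \<langle>$\<rangle> (0, 0, 0, 0) = (0, 0, 0, 0)"
      using f(1) by (simp add: apply_alpha[OF f(1)] shift_def valid_def)
    then have "inverse h \<langle>$\<rangle> (g \<langle>$\<rangle> p) = (0, 0, 0, 0)"
      unfolding f(2)[symmetric] by (simp add: apply_times h(2))
    then have "g \<langle>$\<rangle> p = p"
      using h(2) by (metis apply_inverse_apply(2))
    then show ?thesis by simp
  next
    case False
    then show ?thesis
      using g G_subset_perms_on perms_onD by fastforce
  qed
qed

section \<open>Three-cycles and almost simplicity\<close>

lemma linked_base:
  assumes "0 < w" "w < r"
  shows "cyc3_linked G (1, 1, 0, 0) (1, 0, 0, w)"
proof -
  obtain \<rho> where \<rho>: "\<rho> \<in> R" "\<rho> 0 = w"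
    using R_transitive[of 0 w] assms by auto
  \<comment> \<open>The resulting \<open>a\<close> moves only points of the block of
    \<open>(1, 0)\<close>, and it sends 0 to \<open>w\<close> there.\<close>
  define f where "f = (\<lambda>j i. if j = (1 :: nat) \<and> i = (0 :: nat) then \<rho> else id_r)"
  have v: "valid f id_s"
    using \<rho> R_id S_id r by (simp add: valid_def f_def)
  define a where "a = alpha f id_s"
  define q where "q = (1 :: nat, 1 :: nat, 0 :: nat, 0 :: nat)"
  have q: "q \<in> points" "(1, 1, 0, w) \<in> points"
    using m s r assms by (auto simp: q_def points_iff coord_def)
  have aq: "a \<langle>$\<rangle> q = (1, 1, 0, w)"
    unfolding a_def q_def apply_alpha[OF v] using q \<rho> s by (simp add: q_def shift_def f_def)
  have tq: "t \<langle>$\<rangle> q = q"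
    by (simp add: q_def apply_t)
  have taq: "t \<langle>$\<rangle> (a \<langle>$\<rangle> q) = (1, 0, 0, w)"
    using q assms by (simp add: aq apply_t tau_def)
  have fixes_a: "a \<langle>$\<rangle> (k, j, i, z) = (k, j, i, z)" if "\<not> (j = 1 \<and> i = 0)" for k j i z
    unfolding a_def apply_alpha[OF v] using that by (auto simp: f_def shift_def points_iff coord_def)
  \<comment> \<open>Conjugation by \<open>t\<close> carries the support of \<open>a\<close> to the
    block of \<open>(0, 0)\<close>, except for \<open>q\<close>, which \<open>t\<close> fixes. Hence
    the two supports share \<open>q\<close> only.\<close>
  have supp: "a \<langle>$\<rangle> x = x \<or> (t * a * t) \<langle>$\<rangle> x = x" if "x \<noteq> q" for x
  proof -
    obtain k j i z where x: "x = (k, j, i, z)"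
      by (cases x)
    show ?thesis
    proof (cases "j = 1 \<and> i = 0 \<and> x \<in> points")
      case True
      then have "t \<langle>$\<rangle> x = (k, 0, 0, z)"
        using that x m by (auto simp: apply_t q_def tau_def)
      then have "a \<langle>$\<rangle> (t \<langle>$\<rangle> x) = t \<langle>$\<rangle> x"
        using fixes_a by simp
      then show ?thesis
        by (simp add: apply_times)
    next
      case False
      then show ?thesis
        using fixes_a[of j i k z] x perms_onD[OF alpha_perms_on[OF v], of x, folded a_def] by blast
    qed
  qed
  have hq: "(t * a * t) \<langle>$\<rangle> q = (1, 0, 0, w)"
    using tq taq by (simp add: apply_times)
  have ne: "a \<langle>$\<rangle> q \<noteq> q" "(t * a * t) \<langle>$\<rangle> q \<noteq> q"
    using aq hq assms by (auto simp: q_def)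
  have c1: "distinct [q, a \<langle>$\<rangle> q, (t * a * t) \<langle>$\<rangle> q]"
    by (rule commutator_cyc3[OF ne]) (rule supp)
  have c2: "a * (t * a * t) * inverse a * inverse (t * a * t) = cyc3 q (a \<langle>$\<rangle> q) ((t * a * t) \<langle>$\<rangle> q)"
    by (rule commutator_cyc3[OF ne]) (rule supp)
  have "a \<in> G"
    using A_subset_G alpha_mem_A[OF v] by (auto simp: a_def)
  then have "a * (t * a * t) * inverse a * inverse (t * a * t) \<in> G"
    using perm_closedD(2,3)[OF perm_closed_G] t_in_G by metis
  then have "cyc3 q (1, 1, 0, w) (1, 0, 0, w) \<in> G"
    using c2 by (simp only: aq hq)
  moreover have "distinct [q, (1, 1, 0, w), (1, 0, 0, w)]"
    using c1 by (simp only: aq hq)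
  ultimately show ?thesis
    using cyc3_linkedI[OF perm_closed_G] unfolding q_def by blast
qed

text \<open>The linkage class of \<open>(1, 1, 0, 0)\<close> is a block, so an element of
  \<open>G\<close> preserves it as soon as it sends one member to a member. For \<open>t\<close>
  this member is \<open>(1, 1, 0, 0)\<close>, which it fixes.\<close>

lemma all_linked:
  assumes "p \<in> points" "p' \<in> points"
  shows "cyc3_linked G p p'"
proof -
  let ?q = "(1, 1, 0, 0)"
  let ?C = "{p. cyc3_linked G ?q p}"
  note sym = cyc3_linked_sym[OF perm_closed_G] and trans = cyc3_linked_trans[OF perm_closed_G]
  have conj: "g * n * inverse g \<in> G" if "g \<in> G" "n \<in> G" for g n
    using that perm_closedD(2,3)[OF perm_closed_G] by metis
  have invariant: "g \<langle>$\<rangle> x \<in> ?C" if "g \<in> G" "c \<in> ?C" "g \<langle>$\<rangle> c \<in> ?C" "x \<in> ?C" for g c x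
  proof -
    have "cyc3_linked G c x"
      using that sym trans by blast
    then have "cyc3_linked G (g \<langle>$\<rangle> c) (g \<langle>$\<rangle> x)"
      by (rule cyc3_linked_image[OF perm_closed_G]) (rule conj[OF that(1)])
    then show ?thesis
      using that(3) trans by blast
  qed
  have refl: "?q \<in> ?C"
    by (simp add: cyc3_linked_def)
  have "points \<subseteq> ?C"
  proof (rule points_subset_invariant[OF refl])
    show "t \<langle>$\<rangle> x \<in> ?C" if "x \<in> ?C" for x
    proof (rule invariant[OF t_in_G refl _ that])
      show "t \<langle>$\<rangle> ?q \<in> ?C"
        using refl by (simp add: apply_t)
    qed
    show "a \<langle>$\<rangle> x \<in> ?C" if a: "a \<in> A" and x: "x \<in> ?C" for a x
    proof (rule invariant[OF _ _ _ x])
      show "a \<in> G"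
        using a A_subset_G by blast
      \<comment> \<open>For \<open>A\<close> the witness is in the block of the fixed coordinate:
        \<open>a\<close> permutes the nonzero \<open>z\<close> of this block, and all of them are
        linked to the base point.\<close>
      show "(1, 0, 0, 1) \<in> ?C"
        using linked_base[of 1] r by simp
      obtain f \<sigma> where f: "valid f \<sigma>" "a = alpha f \<sigma>"
        using a by (rule A_cases)
      have "(1, 0, 0, 1) \<in> points"
        using r by (simp add: points_iff coord_def)
      then have "a \<langle>$\<rangle> (1, 0, 0, 1) = (1, 0, 0, f 0 0 1)"
        unfolding f(2) by (simp add: apply_alpha[OF f(1)] shift_def)
      moreover have "f 0 0 \<in> R" "f 0 0 0 = 0"
        using f(1) by (auto simp: valid_def)
      then have "0 < f 0 0 1" "f 0 0 1 < r"
        using R_less[of "f 0 0" 1] R_eq_iff[of "f 0 0" 1 0] r by auto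
      ultimately show "a \<langle>$\<rangle> (1, 0, 0, 1) \<in> ?C"
        using linked_base by simp
    qed
  qed
  then show ?thesis
    using assms sym trans by blast
qed

lemma card_points: "card points \<ge> 5"
proof -
  have "{0} \<times> {1..3} \<times> {..<2} \<times> {..<2} \<subseteq> points"
    using m s r by (auto simp: points_iff coord_def)
  from card_mono[OF finite_points this] show ?thesis
    by (simp add: card_cartesian_product)
qed

lemma almost_simple_G: "almost_simple (perm_monoid G)"
proof (rule almost_simple_perm_monoid[OF finite_points card_points perm_closed_G G_subset_perms_on])
  show "alt_perms points \<subseteq> G"
    using cyc3_mem_of_linked[OF perm_closed_G all_linked G_subset_perms_on]
    by (intro alt_perms_subset[OF perm_closed_G])
qed

section \<open>The local action as an imprimitive wreath product\<close>

definition local_act :: "(nat \<times> nat \<times> nat \<times> nat) perm \<Rightarrow> nat \<times> nat \<Rightarrow> nat \<times> nat" where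
  "local_act a = (\<lambda>(z, i)\<in>{..<r} \<times> {..<s}. case a \<langle>$\<rangle> (0, 1, i, z) of (k, j, i', z') \<Rightarrow> (z', i'))"

lemma row_mem_points: "i < s \<Longrightarrow> z < r \<Longrightarrow> 1 \<le> j \<Longrightarrow> j \<le> m \<Longrightarrow> (0, j, i, z) \<in> points"
  by (simp add: points_iff coord_def)

lemma local_act_alpha:
  assumes "valid f \<sigma>" "z < r" "i < s"
  shows "local_act (alpha f \<sigma>) (z, i) = (f 1 i z, \<sigma> i)"
proof -
  have "(0, 1, i, z) \<in> points"
    using assms m by (intro row_mem_points) auto
  then show ?thesis
    using assms(2,3) by (simp add: local_act_def apply_alpha[OF assms(1)] shift_def)
qed

lemma local_act_image: "local_act ` A = wreath_imprimitive {..<r} R {..<s} S"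
proof (intro subset_antisym subsetI)
  fix w assume "w \<in> local_act ` A"
  then obtain f \<sigma> where v: "valid f \<sigma>" and w: "w = local_act (alpha f \<sigma>)"
    by (auto simp: A_def)
  have "w = (\<lambda>(z, i)\<in>{..<r} \<times> {..<s}. (f 1 i z, \<sigma> i))"
  proof (rule extensionalityI[of _ "{..<r} \<times> {..<s}"])
    show "w \<in> extensional ({..<r} \<times> {..<s})"
      by (simp add: w local_act_def)
  qed (auto simp: w local_act_alpha[OF v])
  moreover have "f 1 \<in> {..<s} \<rightarrow> R" "\<sigma> \<in> S"
    using v by (auto simp: valid_def)
  ultimately show "w \<in> wreath_imprimitive {..<r} R {..<s} S"
    unfolding wreath_imprimitive_def by blast
next
  fix w assume "w \<in> wreath_imprimitive {..<r} R {..<s} S"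
  then obtain f \<sigma> where f: "f \<in> {..<s} \<rightarrow> R" and \<sigma>: "\<sigma> \<in> S"
    and w: "w = (\<lambda>(z, i)\<in>{..<r} \<times> {..<s}. (f i z, \<sigma> i))"
    by (auto simp: wreath_imprimitive_def)
  \<comment> \<open>The given \<open>f\<close> is prescribed at \<open>j = 1\<close> and extended by
    the identity, which lies in \<open>R\<close> and fixes 0, as validity demands.\<close>
  define f' where "f' = (\<lambda>j i. if j = (1 :: nat) \<and> i < s then f i else id_r)"
  have v: "valid f' \<sigma>"
    using f \<sigma> R_id r by (auto simp: valid_def f'_def)
  have "w = local_act (alpha f' \<sigma>)"
  proof (rule extensionalityI[of _ "{..<r} \<times> {..<s}"])
    show "local_act (alpha f' \<sigma>) \<in> extensional ({..<r} \<times> {..<s})"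
      by (simp add: local_act_def)
  qed (auto simp: w local_act_alpha[OF v], simp add: f'_def)
  then show "w \<in> local_act ` A"
    using alpha_mem_A[OF v] by blast
qed

lemma local_act_Bij:
  assumes "a \<in> A"
  shows "local_act a \<in> Bij ({..<r} \<times> {..<s})"
proof -
  obtain f \<sigma> where v: "valid f \<sigma>" and a: "a = alpha f \<sigma>"
    using assms by (rule A_cases)
  then have f: "f j i \<in> R" and \<sigma>: "\<sigma> \<in> S" for j i
    by (auto simp: valid_def)
  have "inj_on (local_act a) ({..<r} \<times> {..<s})"
    using f \<sigma> by (auto simp: inj_on_def a local_act_alpha[OF v] S_eq_iff R_eq_iff)
  moreover have "local_act a ` ({..<r} \<times> {..<s}) \<subseteq> {..<r} \<times> {..<s}"
    using f \<sigma> by (auto simp: a local_act_alpha[OF v] S_less R_less)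
  ultimately have "bij_betw (local_act a) ({..<r} \<times> {..<s}) ({..<r} \<times> {..<s})"
    using endo_inj_surj[of "{..<r} \<times> {..<s}"] by (simp add: bij_betw_def)
  then show ?thesis
    by (simp add: Bij_def local_act_def)
qed

text \<open>The pair \<open>(0, 0)\<close> stands for the point \<open>(0, 1, 0, 0)\<close>, the
  image under \<open>t\<close> of the point \<open>(0, 0, 0, 0)\<close> that \<open>A\<close> fixes.
  If \<open>t * a * t\<close> lies in \<open>A\<close>, then \<open>a\<close> therefore fixes
  \<open>(0, 1, 0, 0)\<close>; the converse is \<open>t_conj_alpha\<close>.\<close>

lemma local_act_stabiliser:
  assumes "a \<in> A"
  shows "local_act a (0, 0) = (0, 0) \<longleftrightarrow> t * a * t \<in> A"
proof -
  obtain f \<sigma> where v: "valid f \<sigma>" and a: "a = alpha f \<sigma>"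
    using assms by (rule A_cases)
  have pt: "(0, 1, 0, 0) \<in> points" "(0, 0, 0, 0) \<in> points"
    using r s m by (auto simp: points_iff coord_def)
  have t0: "t \<langle>$\<rangle> (0, 0, 0, 0) = (0, 1, 0, 0)"
    using pt m by (simp add: apply_t tau_def)
  have "local_act a (0, 0) = (f 1 0 0, \<sigma> 0)"
    using r s by (simp add: a local_act_alpha[OF v])
  moreover have "t * a * t \<in> A" if "f 1 0 0 = 0" "\<sigma> 0 = 0"
    using t_conj_alpha[OF v that(2,1)] alpha_mem_A by (simp add: a)
  moreover have "f 1 0 0 = 0 \<and> \<sigma> 0 = 0" if tat: "t * a * t \<in> A"
  proof -
    obtain f' \<sigma>' where v': "valid f' \<sigma>'" and a': "t * a * t = alpha f' \<sigma>'"
      using tat by (rule A_cases)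
    have "(t * a * t) \<langle>$\<rangle> (0, 0, 0, 0) = (0, 0, 0, 0)"
      using v' pt by (simp add: a' apply_alpha[OF v'] shift_def valid_def)
    then have "t \<langle>$\<rangle> (a \<langle>$\<rangle> (0, 1, 0, 0)) = (0, 0, 0, 0)"
      by (simp add: apply_times t0)
    then have "a \<langle>$\<rangle> (0, 1, 0, 0) = (0, 1, 0, 0)"
      by (metis t_t t0)
    then show ?thesis
      using pt by (simp add: a apply_alpha[OF v] shift_def)
  qed
  ultimately show ?thesis
    by auto
qed

lemma coset_graph_local_action:
  assumes "\<forall>g\<in>G. \<forall>h\<in>G. \<phi> g = \<phi> h \<longleftrightarrow> inverse g * h \<in> A"
  shows "coset_graph_local_action G A t \<phi> ({..<r} \<times> {..<s}) (0, 0) local_act"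
proof
  show "finite G"
    using G_subset_perms_on finite_perms_on[OF finite_points] by (rule finite_subset)
  show "t \<notin> A"
  proof
    assume "t \<in> A"
    then obtain f \<sigma> where v: "valid f \<sigma>" and "t = alpha f \<sigma>"
      by (rule A_cases)
    then have "t \<langle>$\<rangle> (0, 0, 0, 0) = (0, 0, 0, 0)"
      by (simp add: apply_alpha[OF v] shift_def valid_def)
    then show False
      using r by (simp add: apply_t tau_def points_iff coord_def)
  qed
  show "perm_span (insert t A) = G"
    by (simp add: G_def)
  show "local_act (a * b) l = local_act a (local_act b l)" if ab: "a \<in> A" "b \<in> A" and l: "l \<in> {..<r} \<times> {..<s}" for a b l
  proof -
    obtain f \<sigma> f' \<sigma>' where v: "valid f \<sigma>" "valid f' \<sigma>'" and eq: "a = alpha f \<sigma>" "b = alpha f' \<sigma>'"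
      using ab by (elim A_cases)
    obtain z i where zi: "l = (z, i)" "z < r" "i < s"
      using l by blast
    have less: "f' 1 i z < r" "\<sigma>' i < s"
      using v(2) zi R_less S_less by (auto simp: valid_def)
    have "local_act (a * b) l = (compose {..<r} (f 1 (shift \<sigma>' 1 i)) (f' 1 i) z, compose {..<s} \<sigma> \<sigma>' i)"
      unfolding eq alpha_mult(2)[OF v] zi(1) by (rule local_act_alpha[OF alpha_mult(1)[OF v] zi(2,3)])
    also have "\<dots> = (f 1 (\<sigma>' i) (f' 1 i z), \<sigma> (\<sigma>' i))"
      using zi by (simp add: compose_def shift_def)
    also have "\<dots> = local_act a (local_act b l)"
      unfolding eq zi(1) local_act_alpha[OF v(2) zi(2,3)] local_act_alpha[OF v(1) less] ..
    finally show ?thesis .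
  qed
  show "\<exists>a\<in>A. local_act a (0, 0) = l" if l: "l \<in> {..<r} \<times> {..<s}" for l
  proof -
    obtain z i where zi: "l = (z, i)" "z < r" "i < s"
      using l by blast
    obtain a where "a \<in> A" "a \<langle>$\<rangle> (0, 1, 0, 0) = (0, 1, i, z)"
      using A_transitive[of 0 1 0 i 0 z] zi r s m by auto
    then show ?thesis
      using zi r s by (intro bexI[of _ a]) (simp_all add: local_act_def)
  qed
  show "(0, 0) \<in> {..<r} \<times> {..<s}"
    using r s by simp
qed (use assms perm_closed_G perm_closed_A A_subset_G t_in_G t_mult_t G_core local_act_Bij local_act_stabiliser in blast)+

section \<open>The kernel of an arc\<close>

text \<open>
  The arc kernel is trivial on the coordinates \<open>(1, i)\<close>, which index the blocks of neighbours of \<open>x\<close>,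
  and on their images \<open>(0, 0)\<close> and \<open>(2, i)\<close>, \<open>i > 0\<close>, under \<open>t\<close>; it is free on the remaining ones.
\<close>

definition free_coords :: "(nat \<times> nat) set" where
  "free_coords = insert (2, 0) ({3..m} \<times> {..<s})"

definition kernel_base :: "(nat \<times> nat \<times> nat \<times> nat) perm set" where
  "kernel_base = {c \<in> A. (\<forall>l\<in>{..<r} \<times> {..<s}. local_act c l = l) \<and> t * c * t \<in> A \<and>
     (\<forall>l\<in>{..<r} \<times> {..<s}. local_act (t * c * t) l = l)}"

lemma card_free_coords: "finite free_coords" "card free_coords = s * (m - 2) + 1"
proof -
  show "finite free_coords"
    by (simp add: free_coords_def)
  have "card ({3..m} \<times> {..<s}) = s * (m - 2)"
    using m by (simp add: card_cartesian_product Suc_diff_le)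
  then show "card free_coords = s * (m - 2) + 1"
    by (simp add: free_coords_def)
qed

lemma coord_free: "(j, i) \<in> free_coords \<Longrightarrow> coord j i"
  using m s by (auto simp: free_coords_def coord_def)

lemma kernel_base_eq:
  "kernel_base = {alpha f id_s | f. valid f id_s \<and> (\<forall>j i. (j, i) \<notin> free_coords \<longrightarrow> f j i = id_r)}"
proof (intro subset_antisym subsetI)
  fix c assume "c \<in> kernel_base"
  then have c: "c \<in> A" "\<And>z i. z < r \<Longrightarrow> i < s \<Longrightarrow> local_act c (z, i) = (z, i)"
    "\<And>z i. z < r \<Longrightarrow> i < s \<Longrightarrow> local_act (t * c * t) (z, i) = (z, i)"
    by (auto simp: kernel_base_def)
  obtain f \<sigma> where v: "valid f \<sigma>" and cf: "c = alpha f \<sigma>"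
    using c(1) by (rule A_cases)
  have f1: "f 1 i z = z" and \<sigma>: "\<sigma> i = i" if "z < r" "i < s" for z i
    using c(2)[OF that] that by (auto simp: cf local_act_alpha[OF v])
  have "\<sigma> 0 = 0" "f 1 0 0 = 0"
    using f1 \<sigma> r s by auto
  note conj = t_conj_alpha[OF v this]
  have f_tau: "f (tau 1 i) i z = z" if "z < r" "i < s" for z i
    using c(3)[OF that] that by (simp add: cf conj(2) local_act_alpha[OF conj(1)])
  have "f j i z = z" if ji: "coord j i" "z < r" "(j, i) \<notin> free_coords" for j i z
  proof -
    \<comment> \<open>These are the coordinates that are not free. The first and third kinds are the
      values of \<open>tau 1 i\<close>, handled by \<open>f_tau\<close>; the second is handled by
      \<open>f1\<close>.\<close>
    consider "j = 0" "i = 0" | "j = 1" "i < s" | "j = 2" "i \<noteq> 0" "i < s"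
      using ji by (fastforce simp: coord_def free_coords_def)
    then show ?thesis
    proof cases
      case 1
      then show ?thesis
        using f_tau[of z 0] ji s by (simp add: tau_def)
    next
      case 2
      then show ?thesis
        using f1 ji by simp
    next
      case 3
      then have "tau 1 i = 2"
        using m by (simp add: tau_def)
      then show ?thesis
        using f_tau[of z i] ji 3 by simp
    qed
  qed
  \<comment> \<open>The element \<open>c\<close> determines \<open>f\<close> only on actual
    coordinates. Setting \<open>f\<close> to the identity off the free coordinates gives the normal
    form from which \<open>kernel_base_iso\<close> reads off a tuple.\<close>
  then have "c = alpha (\<lambda>j i. if (j, i) \<in> free_coords then f j i else id_r) id_s"
    unfolding cf using \<sigma> r by (intro alpha_cong) auto
  moreover have "valid (\<lambda>j i. if (j, i) \<in> free_coords then f j i else id_r) id_s"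
    using v R_id S_id r by (auto simp: valid_def)
  ultimately show "c \<in> {alpha f id_s | f. valid f id_s \<and> (\<forall>j i. (j, i) \<notin> free_coords \<longrightarrow> f j i = id_r)}"
    by force
next
  fix c assume "c \<in> {alpha f id_s | f. valid f id_s \<and> (\<forall>j i. (j, i) \<notin> free_coords \<longrightarrow> f j i = id_r)}"
  then obtain f where v: "valid f id_s" and c: "c = alpha f id_s"
    and triv: "\<And>j i. (j, i) \<notin> free_coords \<Longrightarrow> f j i = id_r"
    by blast
  have f1: "f 1 i = id_r" for i
    using triv[of 1 i] by (simp add: free_coords_def)
  have f_tau: "f (tau 1 i) i = id_r" for i
    using triv[of "tau 1 i" i] m by (auto simp: free_coords_def tau_def)
  have "id_s 0 = 0" "f 1 0 0 = 0"
    using f1 r s by auto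
  note conj = t_conj_alpha[OF v this]
  have "local_act c (z, i) = (z, i)" "local_act (t * c * t) (z, i) = (z, i)" if "z < r" "i < s" for z i
    unfolding c conj(2) local_act_alpha[OF v that] local_act_alpha[OF conj(1) that]
    using f1 f_tau that by simp_all
  moreover have "c \<in> A" "t * c * t \<in> A"
    using alpha_mem_A[OF v] alpha_mem_A[OF conj(1)] unfolding c conj(2) .
  ultimately show "c \<in> kernel_base"
    unfolding kernel_base_def by auto
qed

text \<open>The free coordinates are numbered by \<open>e\<close>, and a tuple over \<open>R\<close>
  becomes the family of components there. With trivial \<sigma> the coordinates stay in place, so
  the wreath multiplication is componentwise.\<close>

lemma kernel_base_iso:
  "product_group {..<s * (m - 2) + 1} (\<lambda>_. perm_group {..<r} R) \<cong> perm_monoid kernel_base"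
proof -
  let ?N = "{..<s * (m - 2) + 1}"
  let ?P = "product_group ?N (\<lambda>_. perm_group {..<r} R)"
  obtain e where e: "bij_betw e free_coords ?N"
    using ex_bij_betw_finite_nat[OF card_free_coords(1)] card_free_coords(2)
    by (auto simp: atLeast0LessThan)
  have e_mem: "e (j, i) \<in> ?N" if "(j, i) \<in> free_coords" for j i
    using e that by (auto simp: bij_betw_def)
  define ext where "ext F = (\<lambda>j i. if (j, i) \<in> free_coords then F (e (j, i)) else id_r)"
    for F :: "nat \<Rightarrow> nat \<Rightarrow> nat"
  define \<Theta> where "\<Theta> F = alpha (ext F) id_s" for F
  \<comment> \<open>The coordinate \<open>(0, 0)\<close> is not free, so its component is the
    identity and the stabiliser condition holds for every tuple.\<close>
  have v: "valid (ext F) id_s" if "F \<in> carrier ?P" for F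
    using that e_mem R_id S_id r by (auto simp: valid_def ext_def free_coords_def PiE_iff)
  have "\<Theta> (F \<otimes>\<^bsub>?P\<^esub> F') = \<Theta> F * \<Theta> F'" if F: "F \<in> carrier ?P" "F' \<in> carrier ?P" for F F'
  proof -
    have B: "F (e (j, i)) \<in> Bij {..<r}" "F' (e (j, i)) \<in> Bij {..<r}" if "(j, i) \<in> free_coords" for j i
      using F e_mem[OF that] transitive_perm_groupD(1)[OF R] by (auto simp: PiE_iff)
    have less: "F' (e (j, i)) z < r" if "(j, i) \<in> free_coords" "z < r" for j i z
      using F e_mem[OF that(1)] that(2) R_less by (auto simp: PiE_iff)
    show ?thesis
      unfolding \<Theta>_def alpha_mult(2)[OF v[OF F(1)] v[OF F(2)]]
    proof (rule alpha_cong)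
      fix j i z assume *: "coord j i" "z < r"
      then have "shift id_s j i = i"
        by (auto simp: shift_def coord_def)
      then show "ext (F \<otimes>\<^bsub>?P\<^esub> F') j i z = compose {..<r} (ext F j (shift id_s j i)) (ext F' j i) z"
        using * B e_mem less by (simp add: ext_def compose_def BijGroup_def)
    qed (simp add: compose_def)
  qed
  moreover have "\<Theta> ` carrier ?P = kernel_base"
  proof (intro subset_antisym subsetI)
    fix c assume "c \<in> \<Theta> ` carrier ?P"
    then obtain F where F: "F \<in> carrier ?P" "c = alpha (ext F) id_s"
      by (auto simp: \<Theta>_def)
    moreover have "ext F j i = id_r" if "(j, i) \<notin> free_coords" for j i
      using that by (simp add: ext_def)
    ultimately show "c \<in> kernel_base"
      using v[OF F(1)] unfolding kernel_base_eq by blast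
  next
    fix c assume "c \<in> kernel_base"
    then obtain f where f: "valid f id_s" "c = alpha f id_s" 
      "\<And>j i. (j, i) \<notin> free_coords \<Longrightarrow> f j i = id_r"
      by (auto simp: kernel_base_eq)
    define F where "F = (\<lambda>n\<in>?N. case inv_into free_coords e n of (j, i) \<Rightarrow> f j i)"
    have "F \<in> carrier ?P"
      using f(1) by (auto simp: F_def valid_def split: prod.splits)
    moreover have "F (e (j, i)) = f j i" if "(j, i) \<in> free_coords" for j i
      using that e e_mem[OF that] by (simp add: F_def bij_betw_inv_into_left)
    then have "ext F = f"
      using f(3) by (auto simp: ext_def fun_eq_iff)
    ultimately show "c \<in> \<Theta> ` carrier ?P"
      using f(2) by (auto simp: \<Theta>_def)
  qed
  moreover have "inj_on \<Theta> (carrier ?P)"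
  proof (rule inj_onI)
    fix F F' assume F: "F \<in> carrier ?P" "F' \<in> carrier ?P" and eq: "\<Theta> F = \<Theta> F'"
    show "F = F'"
    proof (rule PiE_ext)
      show "F \<in> (\<Pi>\<^sub>E n\<in>?N. R)" "F' \<in> (\<Pi>\<^sub>E n\<in>?N. R)"
        using F by simp_all
      fix n assume n: "n \<in> ?N"
      then obtain j i where ji: "(j, i) \<in> free_coords" "n = e (j, i)"
        using e by (metis bij_betw_imp_surj_on imageE surj_pair)
      show "F n = F' n"
      proof (rule extensionalityI[of _ "{..<r}"])
        have "F n \<in> R" "F' n \<in> R"
          using F n by (auto simp: PiE_iff)
        then show "F n \<in> extensional {..<r}" "F' n \<in> extensional {..<r}"
          using transitive_perm_groupD(1)[OF R] by (auto simp: Bij_def)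
        fix z assume z: "z \<in> {..<r}"
        have c: "coord j i"
          by (rule coord_free[OF ji(1)])
        then have pt: "(0, j, i, z) \<in> points"
          using z by (simp add: points_iff)
        have "\<Theta> F \<langle>$\<rangle> (0, j, i, z) = (0, j, shift id_s j i, F n z)"
          unfolding \<Theta>_def apply_alpha[OF v[OF F(1)]] using pt ji by (simp add: ext_def)
        moreover have "\<Theta> F' \<langle>$\<rangle> (0, j, i, z) = (0, j, shift id_s j i, F' n z)"
          unfolding \<Theta>_def apply_alpha[OF v[OF F(2)]] using pt ji by (simp add: ext_def)
        ultimately show "F n z = F' n z"
          using eq by simp
      qed
    qed
  qed
  ultimately have "\<Theta> \<in> iso ?P (perm_monoid kernel_base)"
    unfolding iso_def hom_def bij_betw_def by auto
  then show ?thesis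
    by (auto simp: is_iso_def)
qed

lemma group_product_R: "group (product_group I (\<lambda>_. perm_group {..<r} R))"
proof (rule product_group)
  show "group (perm_group {..<r} R)"
    using R subgroup.subgroup_is_group[OF _ group_BijGroup] by (auto simp: transitive_perm_group_def)
qed

end

section \<open>The coset graph of the construction\<close>

theorem theorem4:
  fixes r s m :: nat and R S :: "(nat \<Rightarrow> nat) set"
  assumes "r > 1" and "s > 1"
    and "transitive_perm_group {..<r} R"
    and "transitive_perm_group {..<s} S"
    and "m \<ge> 3" and "odd m"
  shows "\<exists>(\<Delta> :: nat pair_pre_digraph) G.
    pair_graph \<Delta> \<and> connected (with_proj \<Delta>) \<and>
    (\<forall>x\<in>pverts \<Delta>. card (neighbours \<Delta> x) = r * s) \<and>
    subgroup G (graph_AutGroup \<Delta>) \<and>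
    almost_simple (perm_group (pverts \<Delta>) G) \<and>
    arc_transitive \<Delta> G \<and>
    (\<forall>x y. (x, y) \<in> parcs \<Delta> \<longrightarrow>
       perm_isomorphic (neighbours \<Delta> x) (local_group \<Delta> G x)
         ({..<r} \<times> {..<s}) (wreath_imprimitive {..<r} R {..<s} S) \<and>
       perm_group (pverts \<Delta>) (arc_kernel \<Delta> G x y) \<cong>
         product_group {..<s * (m - 2) + 1} (\<lambda>_. perm_group {..<r} R))"
proof -
  interpret W: wreath_construction r s m R S
    using assms by unfold_locales
  have fin: "finite W.G"
    using W.G_subset_perms_on finite_perms_on[OF W.finite_points] by (rule finite_subset)
  obtain \<phi> :: "(nat \<times> nat \<times> nat \<times> nat) perm \<Rightarrow> nat"
    where \<phi>: "\<forall>g\<in>W.G. \<forall>h\<in>W.G. \<phi> g = \<phi> h \<longleftrightarrow> inverse g * h \<in> W.A"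
    using ex_coset_labelling[OF W.perm_closed_A fin] by blast
  interpret C: coset_graph_local_action W.G W.A W.t \<phi> "{..<r} \<times> {..<s}" "(0, 0)" W.local_act
    using \<phi> by (rule W.coset_graph_local_action)
  let ?G = "C.act ` W.G"
  have base: "C.arc_kernel_base = W.kernel_base"
    unfolding C.arc_kernel_base_def W.kernel_base_def ..
  have "perm_isomorphic (neighbours C.graph x) (local_group C.graph ?G x)
         ({..<r} \<times> {..<s}) (wreath_imprimitive {..<r} R {..<s} S)"
    and "perm_group (pverts C.graph) (arc_kernel C.graph ?G x y) \<cong>
         product_group {..<s * (m - 2) + 1} (\<lambda>_. perm_group {..<r} R)"
    if xy: "(x, y) \<in> parcs C.graph" for x y
  proof -
    obtain g where g: "g \<in> W.G" "x = \<phi> g" "y = \<phi> (g * W.t)"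
      using xy by (rule C.arcE)
    show "perm_isomorphic (neighbours C.graph x) (local_group C.graph ?G x)
         ({..<r} \<times> {..<s}) (wreath_imprimitive {..<r} R {..<s} S)"
      using C.local_group_perm_isomorphic[OF g(1)] unfolding g(2) W.local_act_image .
    show "perm_group (pverts C.graph) (arc_kernel C.graph ?G x y) \<cong>
         product_group {..<s * (m - 2) + 1} (\<lambda>_. perm_group {..<r} R)"
      using group.iso_sym[OF W.group_product_R iso_trans[OF W.kernel_base_iso C.arc_kernel_iso[OF g(1), unfolded base]]]
      unfolding g(2,3) .
  qed
  moreover have "card (neighbours C.graph x) = r * s" if "x \<in> pverts C.graph" for x
    using that C.card_neighbours by (auto simp: card_cartesian_product)
  moreover have "almost_simple (perm_group (pverts C.graph) ?G)"
    using W.almost_simple_G C.act_iso subgroup.subgroup_is_group[OF C.subgroup_BijGroup_act_image group_BijGroup]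
    by (rule almost_simple_iso)
  ultimately show ?thesis
    using C.pair_graph C.connected C.subgroup_act_image C.arc_transitive by blast
qed

end
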